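(* Let $\Phi: G\times M\to M$, $(g,m)\mapsto g\cdot m$, be a proper action of a Lie group $G$ on a smooth manifold $M$, let $\overline{M}=M/G$ be the orbit space with orbit map $\pi$, and let $C^{\infty}(\overline{M})=\{\overline f:\overline{M}\to\mathbb{R} \mid \pi^{*}\overline f=\overline f\circ\pi\in C^{\infty}(M)^G\}$. Then the differential structure $C^{\infty}(\overline{M})$ is continuously reflexive, that is, $$C^{\infty}(\overline{M})=\Phi_0\Gamma_0 C^{\infty}(\overline{M}).$$
   Context: $C^{\infty}(M)^G$ denotes the space of smooth $G$-invariant real valued functions on $M$. $\overline{M}=\{G\cdot m\mid m\in M\}$ carries the quotient topology, $\pi:M\to\overline{M}$ is $m\mapsto G\cdot m$, and $C^0$ denotes continuous functions or maps. For a topological space $S$ with a family $C^{\infty}(S)$ of continuous real valued functions on $S$ put $$\Gamma_0C^{\infty}(S)=\{c\in C^0(\mathbb{R},S)\mid f\circ c\in C^{\infty}(\mathbb{R})\text{ for all }f\in C^{\infty}(S)\},$$ $$\Phi_0\Gamma_0C^{\infty}(S)=\{f\in C^0(S)\mid f\circ c\in C^{\infty}(\mathbb{R})\text{ for all }c\in\Gamma_0C^{\infty}(S)\}.$$ One always has $C^{\infty}(S)\subseteq\Phi_0\Gamma_0C^{\infty}(S)$; $C^{\infty}(S)$ is called continuously reflexive if $\Phi_0\Gamma_0C^{\infty}(S)\subseteq C^{\infty}(S)$. *)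

theory Defs
  imports "HOL-Analysis.Analysis" "HOL-Algebra.Group_Action"
begin

section \<open>Smooth functions on open subsets of Euclidean space\<close>

text \<open>The model space is \<^term>\<open>Euclidean_space n\<close>, so that dimension \<open>0\<close> (in particular,
  discrete Lie groups) is included.\<close>

definition partial_deriv :: "nat \<Rightarrow> ((nat \<Rightarrow> real) \<Rightarrow> real) \<Rightarrow> (nat \<Rightarrow> real) \<Rightarrow> real" where
  "partial_deriv i f x = deriv (\<lambda>t. f (x(i := t))) (x i)"

primrec C_k :: "nat \<Rightarrow> nat \<Rightarrow> (nat \<Rightarrow> real) set \<Rightarrow> ((nat \<Rightarrow> real) \<Rightarrow> real) \<Rightarrow> bool" where
  "C_k n 0 W f \<longleftrightarrow> continuous_map (subtopology (Euclidean_space n) W) euclideanreal f"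
| "C_k n (Suc k) W f \<longleftrightarrow>
     continuous_map (subtopology (Euclidean_space n) W) euclideanreal f \<and>
     (\<forall>i<n. (\<forall>x\<in>W. (\<lambda>t. f (x(i := t))) field_differentiable at (x i)) \<and>
            C_k n k W (partial_deriv i f))"

definition C_infinity :: "nat \<Rightarrow> (nat \<Rightarrow> real) set \<Rightarrow> ((nat \<Rightarrow> real) \<Rightarrow> real) \<Rightarrow> bool" where
  "C_infinity n W f \<longleftrightarrow> (\<forall>k. C_k n k W f)"

definition smooth_real :: "(real \<Rightarrow> real) \<Rightarrow> bool" where
  "smooth_real h \<longleftrightarrow> (\<forall>k t. (deriv ^^ k) h field_differentiable at t)"


section \<open>Smooth manifolds and Lie groups\<close>

text \<open>A chart is a pair \<open>(U, \<phi>)\<close> of a domain and a coordinate map; the values of \<open>\<phi>\<close> outside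
  \<open>U\<close> are irrelevant.\<close>

type_synonym 'a atlas = "('a set \<times> ('a \<Rightarrow> nat \<Rightarrow> real)) set"

definition chart :: "nat \<Rightarrow> 'a topology \<Rightarrow> 'a set \<Rightarrow> ('a \<Rightarrow> nat \<Rightarrow> real) \<Rightarrow> bool" where
  "chart n X U \<phi> \<longleftrightarrow>
     openin X U \<and> openin (Euclidean_space n) (\<phi> ` U) \<and>
     homeomorphic_map (subtopology X U) (subtopology (Euclidean_space n) (\<phi> ` U)) \<phi>"

definition smooth_manifold :: "nat \<Rightarrow> 'a topology \<Rightarrow> 'a atlas \<Rightarrow> bool" where
  "smooth_manifold n X A \<longleftrightarrow>
     Hausdorff_space X \<and> second_countable X \<and>
     (\<forall>(U, \<phi>)\<in>A. chart n X U \<phi>) \<and>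
     (\<Union>(U, \<phi>)\<in>A. U) = topspace X \<and>
     (\<forall>(U, \<phi>)\<in>A. \<forall>(V, \<psi>)\<in>A. \<forall>i<n.
        C_infinity n (\<phi> ` (U \<inter> V)) (\<lambda>x. \<psi> (inv_into U \<phi> x) i))"

definition smooth_map ::
    "nat \<Rightarrow> 'a topology \<Rightarrow> 'a atlas \<Rightarrow> nat \<Rightarrow> 'b topology \<Rightarrow> 'b atlas \<Rightarrow> ('a \<Rightarrow> 'b) \<Rightarrow> bool" where
  "smooth_map n X A m Y B F \<longleftrightarrow>
     continuous_map X Y F \<and>
     (\<forall>(U, \<phi>)\<in>A. \<forall>(V, \<psi>)\<in>B. \<forall>i<m.
        C_infinity n (\<phi> ` (U \<inter> F -` V)) (\<lambda>x. \<psi> (F (inv_into U \<phi> x)) i))"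

definition prod_atlas :: "nat \<Rightarrow> 'a atlas \<Rightarrow> 'b atlas \<Rightarrow> ('a \<times> 'b) atlas" where
  "prod_atlas n A B =
     {(U \<times> V, \<lambda>(x, y) i. if i < n then \<phi> x i else \<psi> y (i - n)) | U \<phi> V \<psi>.
        (U, \<phi>) \<in> A \<and> (V, \<psi>) \<in> B}"

definition smooth_functions :: "nat \<Rightarrow> 'a atlas \<Rightarrow> ('a \<Rightarrow> real) set" where
  "smooth_functions n A = {f. \<forall>(U, \<phi>)\<in>A. C_infinity n (\<phi> ` U) (\<lambda>x. f (inv_into U \<phi> x))}"

definition lie_group :: "nat \<Rightarrow> 'g topology \<Rightarrow> 'g atlas \<Rightarrow> ('g, 'r) monoid_scheme \<Rightarrow> bool" where
  "lie_group d T A G \<longleftrightarrow>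
     group G \<and> smooth_manifold d T A \<and> topspace T = carrier G \<and>
     smooth_map (d + d) (prod_topology T T) (prod_atlas d A A) d T A (\<lambda>(g, h). g \<otimes>\<^bsub>G\<^esub> h) \<and>
     smooth_map d T A d T A (\<lambda>g. inv\<^bsub>G\<^esub> g)"


section \<open>Proper actions and the orbit space\<close>

definition proper_lie_action ::
    "nat \<Rightarrow> 'g topology \<Rightarrow> 'g atlas \<Rightarrow> ('g, 'r) monoid_scheme \<Rightarrow>
     nat \<Rightarrow> 'm topology \<Rightarrow> 'm atlas \<Rightarrow> ('g \<Rightarrow> 'm \<Rightarrow> 'm) \<Rightarrow> bool" where
  "proper_lie_action d T A G n X B \<Phi> \<longleftrightarrow>
     group_action G (topspace X) \<Phi> \<and>
     smooth_map (d + n) (prod_topology T X) (prod_atlas d A B) n X B (\<lambda>(g, m). \<Phi> g m) \<and>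
     proper_map (prod_topology T X) (prod_topology X X) (\<lambda>(g, m). (m, \<Phi> g m))"

definition orbit_space ::
    "('g, 'r) monoid_scheme \<Rightarrow> 'm topology \<Rightarrow> ('g \<Rightarrow> 'm \<Rightarrow> 'm) \<Rightarrow> 'm set topology" where
  "orbit_space G X \<Phi> =
     topology (\<lambda>V. V \<subseteq> orbits G (topspace X) \<Phi> \<and>
                   openin X {m \<in> topspace X. orbit G \<Phi> m \<in> V})"

lemma openin_orbit_space:
  "openin (orbit_space G X \<Phi>) V \<longleftrightarrow>
     V \<subseteq> orbits G (topspace X) \<Phi> \<and> openin X {m \<in> topspace X. orbit G \<Phi> m \<in> V}"
proof -
  have "istopology (\<lambda>V. V \<subseteq> orbits G (topspace X) \<Phi> \<and>
                        openin X {m \<in> topspace X. orbit G \<Phi> m \<in> V})"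
    unfolding istopology_def
  proof (intro conjI allI impI; (elim conjE)?)
    fix S T
    assume "openin X {m \<in> topspace X. orbit G \<Phi> m \<in> S}" "openin X {m \<in> topspace X. orbit G \<Phi> m \<in> T}"
    moreover have "{m \<in> topspace X. orbit G \<Phi> m \<in> S \<inter> T} =
        {m \<in> topspace X. orbit G \<Phi> m \<in> S} \<inter> {m \<in> topspace X. orbit G \<Phi> m \<in> T}"
      by auto
    ultimately show "openin X {m \<in> topspace X. orbit G \<Phi> m \<in> S \<inter> T}"
      by auto
  next
    fix K
    assume "\<forall>S\<in>K. S \<subseteq> orbits G (topspace X) \<Phi> \<and> openin X {m \<in> topspace X. orbit G \<Phi> m \<in> S}"
    moreover have "{m \<in> topspace X. orbit G \<Phi> m \<in> \<Union>K} =
        (\<Union>S\<in>K. {m \<in> topspace X. orbit G \<Phi> m \<in> S})"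
      by auto
    ultimately show "openin X {m \<in> topspace X. orbit G \<Phi> m \<in> \<Union>K}"
      by auto
  qed auto
  then show ?thesis
    by (simp add: orbit_space_def)
qed

lemma topspace_orbit_space: "topspace (orbit_space G X \<Phi>) = orbits G (topspace X) \<Phi>"
proof -
  have "{m \<in> topspace X. orbit G \<Phi> m \<in> orbits G (topspace X) \<Phi>} = topspace X"
    by (auto simp: orbits_def)
  then have "openin (orbit_space G X \<Phi>) (orbits G (topspace X) \<Phi>)"
    by (simp add: openin_orbit_space)
  then show ?thesis
    by (meson openin_orbit_space openin_subset openin_topspace subset_antisym)
qed

lemma quotient_map_orbit: "quotient_map X (orbit_space G X \<Phi>) (orbit G \<Phi>)"
  unfolding quotient_map_def topspace_orbit_space
  by (auto simp: openin_orbit_space orbits_def)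

definition invariant_smooth_functions ::
    "('g, 'r) monoid_scheme \<Rightarrow> nat \<Rightarrow> 'm topology \<Rightarrow> 'm atlas \<Rightarrow> ('g \<Rightarrow> 'm \<Rightarrow> 'm) \<Rightarrow> ('m \<Rightarrow> real) set" where
  "invariant_smooth_functions G n X B \<Phi> =
     {f \<in> smooth_functions n B. \<forall>g\<in>carrier G. \<forall>m\<in>topspace X. f (\<Phi> g m) = f m}"

text \<open>A function on the orbit space is represented by a function on all sets of points. This
  membership condition, like the one in \<open>\<Phi>\<^sub>0\<close> below, only depends on its values on orbits.\<close>

definition orbit_smooth_functions ::
    "('g, 'r) monoid_scheme \<Rightarrow> nat \<Rightarrow> 'm topology \<Rightarrow> 'm atlas \<Rightarrow> ('g \<Rightarrow> 'm \<Rightarrow> 'm) \<Rightarrow> ('m set \<Rightarrow> real) set" where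
  "orbit_smooth_functions G n X B \<Phi> =
     {f. f \<circ> orbit G \<Phi> \<in> invariant_smooth_functions G n X B \<Phi>}"


section \<open>Continuous reflexivity\<close>

definition Gamma0 :: "'s topology \<Rightarrow> ('s \<Rightarrow> real) set \<Rightarrow> (real \<Rightarrow> 's) set" where
  "Gamma0 S F = {c. continuous_map euclideanreal S c \<and> (\<forall>f\<in>F. smooth_real (f \<circ> c))}"

definition Phi0 :: "'s topology \<Rightarrow> (real \<Rightarrow> 's) set \<Rightarrow> ('s \<Rightarrow> real) set" where
  "Phi0 S \<Gamma> = {f. continuous_map S euclideanreal f \<and> (\<forall>c\<in>\<Gamma>. smooth_real (f \<circ> c))}"

definition continuously_reflexive :: "'s topology \<Rightarrow> ('s \<Rightarrow> real) set \<Rightarrow> bool" where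
  "continuously_reflexive S F \<longleftrightarrow> Phi0 S (Gamma0 S F) \<subseteq> F"

end

theory Submission
  imports Defs
begin

text \<open>Let \<open>f\<close> be a continuous function on the orbit space that is smooth along every curve
  of \<open>\<Gamma>\<^sub>0\<close>. A smooth curve in a chart of \<open>M\<close> projects to a curve of \<open>\<Gamma>\<^sub>0\<close>: composing it with
  the pullback of a function in \<open>C\<^sup>\<infinity>(M/G)\<close> gives a smooth function by the chain rule
  (\<open>C_infinity_imp_curve_smooth\<close>). Hence the pullback of \<open>f\<close>, read in any chart, is continuous and
  smooth along all smooth curves, and Boman's theorem (\<open>curve_smooth_imp_C_infinity\<close>) says that such
  a function on an open set of coordinate space is \<open>C\<^sup>\<infinity>\<close>. The other inclusion is formal: a
  function with smooth pullback is continuous on the quotient and is smooth along the curves of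
  \<open>\<Gamma>\<^sub>0\<close> by the definition of \<open>\<Gamma>\<^sub>0\<close>.

  Almost all of the text is a proof of Boman's theorem. Let \<open>h\<close> be smooth along smooth curves. By
  induction on the order it is enough that each partial derivative \<open>\<partial>\<^sub>ih\<close> is continuous and again
  smooth along smooth curves. Two ingredients give this.

  The first is a local bound for each pure derivative \<open>\<partial>\<^sub>i\<^sup>p h\<close>
  (\<open>locally_bounded_slice_derivative\<close>). If \<open>\<partial>\<^sub>i\<^sup>p h\<close> were unbounded near \<open>x\<close>, then points \<open>y\<^sub>m\<close> with very
  large \<open>\<partial>\<^sub>i\<^sup>p h(y\<^sub>m)\<close> could be taken so close to \<open>x\<close> that one smooth curve runs through all of
  them, passing \<open>y\<^sub>m\<close> with a small constant velocity in direction \<open>i\<close>; along that curve the \<open>p\<close>-th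
  derivative of \<open>h\<close> would be unbounded on a compact interval.

  The second is interpolation. For a smooth curve \<open>c\<close> put \<open>F(s,t) = h(c(s) + t e\<^sub>i)\<close>, which is again
  smooth along smooth curves in the plane. The difference quotients
  \<open>q\<^sub>t(s) = (F(s,t) - F(s,0)) / t\<close> converge to \<open>\<partial>\<^sub>ih(c(s))\<close> with error \<open>O(t)\<close>, because \<open>\<partial>\<^sub>i\<^sup>2 h\<close> is
  bounded, while their \<open>N\<close>-th derivatives in \<open>s\<close> are only \<open>O(1/t)\<close>, because \<open>\<partial>\<^sub>s\<^sup>N F\<close> is bounded.
  The Landau-Kolmogorov inequality (\<open>derivative_interpolation\<close>) interpolates between the two bounds:
  for \<open>N\<close> large compared with \<open>p\<close>, the derivatives of order at most \<open>p\<close> of successive differences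
  along a geometric sequence of values of \<open>t\<close> are summable, so the limit \<open>\<partial>\<^sub>ih \<circ> c\<close> is \<open>p\<close> times
  differentiable (\<open>partial_deriv_curve_diff_times\<close>). Mixed derivatives of \<open>F\<close> never enter.\<close>

section \<open>Differentiability of finite order on open sets of reals\<close>

text \<open>Smoothness is kept order by order, since the neighbourhoods obtained below depend on the
  order of differentiability wanted.\<close>

primrec diff_times :: "nat \<Rightarrow> real set \<Rightarrow> (real \<Rightarrow> real) \<Rightarrow> bool" where
  "diff_times 0 S f \<longleftrightarrow> True"
| "diff_times (Suc k) S f \<longleftrightarrow> (\<forall>x\<in>S. f field_differentiable at x) \<and> diff_times k S (deriv f)"

lemma diff_times_iff:
  "diff_times k S f \<longleftrightarrow> (\<forall>j<k. \<forall>x\<in>S. (deriv ^^ j) f field_differentiable at x)"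
proof (induction k arbitrary: f)
  case (Suc k)
  have "(\<forall>j<Suc k. \<forall>x\<in>S. (deriv ^^ j) f field_differentiable at x) \<longleftrightarrow>
     (\<forall>x\<in>S. (deriv ^^ 0) f field_differentiable at x) \<and>
     (\<forall>j<k. \<forall>x\<in>S. (deriv ^^ Suc j) f field_differentiable at x)"
    unfolding All_less_Suc2 ..
  then show ?case
    unfolding diff_times.simps Suc.IH funpow_Suc_right by simp
qed simp

lemma smooth_real_iff: "smooth_real f \<longleftrightarrow> (\<forall>k. diff_times k UNIV f)"
  unfolding smooth_real_def diff_times_iff by auto

lemma diff_times_mono: "diff_times k S f \<Longrightarrow> j \<le> k \<Longrightarrow> T \<subseteq> S \<Longrightarrow> diff_times j T f"
  unfolding diff_times_iff by auto

lemma diff_times_deriv: "diff_times (Suc k) S f \<Longrightarrow> diff_times k S (deriv f)"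
  by simp

lemma deriv_cong_open:
  fixes f g :: "real \<Rightarrow> real"
  assumes "open S" "x \<in> S" "\<And>y. y \<in> S \<Longrightarrow> f y = g y"
  shows "deriv f x = deriv g x"
proof (rule deriv_cong_ev)
  show "\<forall>\<^sub>F y in nhds x. f y = g y"
    using eventually_nhds_in_open[OF assms(1,2)] by eventually_elim (rule assms(3))
qed simp

lemma iterated_deriv_cong_open:
  fixes f g :: "real \<Rightarrow> real"
  assumes "open S" "x \<in> S" "\<And>y. y \<in> S \<Longrightarrow> f y = g y"
  shows "(deriv ^^ k) f x = (deriv ^^ k) g x"
  using assms(2,3)
proof (induction k arbitrary: f g x)
  case (Suc k)
  have "deriv f y = deriv g y" if "y \<in> S" for y
    using deriv_cong_open[OF assms(1) that] Suc.prems(2) by blast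
  then have "(deriv ^^ k) (deriv f) x = (deriv ^^ k) (deriv g) x"
    using Suc by blast
  then show ?case by (simp add: funpow_Suc_right del: funpow.simps)
qed simp

lemma field_differentiable_cong_open:
  fixes f g :: "real \<Rightarrow> real"
  assumes "open S" "x \<in> S" "\<And>y. y \<in> S \<Longrightarrow> f y = g y" "f field_differentiable at x"
  shows "g field_differentiable at x"
proof -
  obtain D where "(f has_field_derivative D) (at x)"
    using assms(4) by (auto simp: field_differentiable_def)
  then have "(g has_field_derivative D) (at x)"
    by (rule has_field_derivative_transform_within_open[OF _ assms(1,2)]) (rule assms(3))
  then show ?thesis
    by (auto simp: field_differentiable_def)
qed

lemma diff_times_cong:
  assumes "open S" "diff_times k S f" "\<And>y. y \<in> S \<Longrightarrow> f y = g y"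
  shows "diff_times k S g"
proof -
  have "(deriv ^^ j) g field_differentiable at x" if "j < k" "x \<in> S" for j x
  proof (rule field_differentiable_cong_open[OF assms(1) that(2)])
    show "(deriv ^^ j) f y = (deriv ^^ j) g y" if "y \<in> S" for y
      by (rule iterated_deriv_cong_open[OF assms(1) that]) (rule assms)
    show "(deriv ^^ j) f field_differentiable at x"
      using assms(2) that by (simp add: diff_times_iff)
  qed
  then show ?thesis
    by (simp add: diff_times_iff)
qed

lemma diff_times_local:
  assumes "\<And>x. x \<in> S \<Longrightarrow> \<exists>U. x \<in> U \<and> diff_times k U f"
  shows "diff_times k S f"
  unfolding diff_times_iff
proof (intro allI impI ballI)
  fix j x assume "j < k" "x \<in> S"
  then show "(deriv ^^ j) f field_differentiable at x"
    using assms[of x] by (auto simp: diff_times_iff)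
qed

lemma diff_times_SucI:
  assumes "open S" "\<And>x. x \<in> S \<Longrightarrow> (f has_field_derivative f' x) (at x)" "diff_times k S f'"
  shows "diff_times (Suc k) S f"
proof -
  have "deriv f x = f' x" if "x \<in> S" for x
    using assms(2) that DERIV_imp_deriv by blast
  moreover have "diff_times k S (deriv f)"
    using assms(1,3) by (rule diff_times_cong) (use calculation in auto)
  ultimately show ?thesis
    using assms(2) by (auto simp: field_differentiable_def)
qed

lemma diff_times_has_deriv:
  assumes "diff_times (Suc k) S f" "x \<in> S"
  shows "(f has_field_derivative deriv f x) (at x)"
  using assms by (simp add: field_differentiable_derivI)

lemma diff_times_has_iterated_deriv:
  assumes "diff_times k S f" "x \<in> S" "j < k"
  shows "((deriv ^^ j) f has_field_derivative (deriv ^^ Suc j) f x) (at x)"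
  using assms by (auto simp: diff_times_iff field_differentiable_derivI)

lemma continuous_on_iterated_deriv:
  assumes "diff_times k S f" "j < k"
  shows "continuous_on S ((deriv ^^ j) f)"
  using assms by (auto simp: diff_times_iff intro!: continuous_at_imp_continuous_on
      field_differentiable_imp_continuous_at)

lemma diff_times_const: "open S \<Longrightarrow> diff_times k S (\<lambda>x. c)"
proof (induction k arbitrary: c)
  case (Suc k)
  show ?case
    by (rule diff_times_SucI[where f' = "\<lambda>x. 0"]) (use Suc in \<open>auto intro!: derivative_eq_intros\<close>)
qed simp

lemma diff_times_ident: "open S \<Longrightarrow> diff_times k S (\<lambda>x. x)"
proof (cases k)
  case (Suc j)
  assume "open S"
  then show ?thesis unfolding Suc
    by (intro diff_times_SucI[where f' = "\<lambda>x. 1"] diff_times_const) auto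
qed simp

lemma diff_times_add:
  "open S \<Longrightarrow> diff_times k S f \<Longrightarrow> diff_times k S g \<Longrightarrow> diff_times k S (\<lambda>x. f x + g x)"
proof (induction k arbitrary: f g)
  case (Suc k)
  show ?case
  proof (rule diff_times_SucI[where f' = "\<lambda>x. deriv f x + deriv g x"])
    show "((\<lambda>x. f x + g x) has_field_derivative deriv f x + deriv g x) (at x)" if "x \<in> S" for x
      using Suc.prems that by (intro DERIV_add diff_times_has_deriv)
  qed (use Suc in auto)
qed simp

lemma diff_times_mult:
  "open S \<Longrightarrow> diff_times k S f \<Longrightarrow> diff_times k S g \<Longrightarrow> diff_times k S (\<lambda>x. f x * g x)"
proof (induction k arbitrary: f g)
  case (Suc k)
  show ?case
  proof (rule diff_times_SucI[where f' = "\<lambda>x. deriv f x * g x + deriv g x * f x"])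
    show "((\<lambda>x. f x * g x) has_field_derivative deriv f x * g x + deriv g x * f x) (at x)"
      if "x \<in> S" for x
      using Suc.prems that by (intro DERIV_mult diff_times_has_deriv)
    show "diff_times k S (\<lambda>x. deriv f x * g x + deriv g x * f x)"
      using Suc.prems diff_times_mono[OF Suc.prems(2), of k S] diff_times_mono[OF Suc.prems(3), of k S]
      by (intro diff_times_add Suc.IH) auto
  qed (use Suc in auto)
qed simp

lemma diff_times_cmult: "open S \<Longrightarrow> diff_times k S f \<Longrightarrow> diff_times k S (\<lambda>x. c * f x)"
  by (intro diff_times_mult diff_times_const)

lemma diff_times_diff:
  "open S \<Longrightarrow> diff_times k S f \<Longrightarrow> diff_times k S g \<Longrightarrow> diff_times k S (\<lambda>x. f x - g x)"
  using diff_times_add[of S k f "\<lambda>x. (-1) * g x"] diff_times_cmult[of S k g "-1"] by simp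

lemma diff_times_sum:
  assumes "open S" "\<And>i. i \<in> I \<Longrightarrow> diff_times k S (f i)"
  shows "diff_times k S (\<lambda>x. \<Sum>i\<in>I. f i x)"
  using assms(2) by (induction I rule: infinite_finite_induct)
    (auto intro!: diff_times_const diff_times_add assms(1))

lemma diff_times_compose:
  assumes "open S"
  shows "diff_times k T f \<Longrightarrow> diff_times k S g \<Longrightarrow> g ` S \<subseteq> T \<Longrightarrow> diff_times k S (\<lambda>x. f (g x))"
proof (induction k arbitrary: f)
  case (Suc k)
  show ?case
  proof (rule diff_times_SucI[OF assms, where f' = "\<lambda>x. deriv f (g x) * deriv g x"])
    fix x assume x: "x \<in> S"
    then have "g x \<in> T"
      using Suc.prems(3) by blast
    then show "((\<lambda>x. f (g x)) has_field_derivative deriv f (g x) * deriv g x) (at x)"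
      by (rule DERIV_chain2[OF diff_times_has_deriv[OF Suc.prems(1)] diff_times_has_deriv[OF Suc.prems(2) x]])
  next
    have "diff_times k S g"
      using Suc.prems(2) by (rule diff_times_mono) auto
    then have "diff_times k S (\<lambda>x. deriv f (g x))"
      using Suc.IH[of "deriv f"] Suc.prems(1,3) by simp
    moreover have "diff_times k S (deriv g)"
      using Suc.prems(2) by simp
    ultimately show "diff_times k S (\<lambda>x. deriv f (g x) * deriv g x)"
      by (rule diff_times_mult[OF assms])
  qed
qed simp

lemma iterated_deriv_affine:
  assumes "open S" "diff_times k T f" "\<And>x. x \<in> S \<Longrightarrow> a + b * x \<in> T" "x \<in> S"
  shows "(deriv ^^ k) (\<lambda>x. f (a + b * x)) x = b ^ k * (deriv ^^ k) f (a + b * x)"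
  using assms(2,4)
proof (induction k arbitrary: x)
  case (Suc k)
  have D: "diff_times k T f"
    using Suc.prems(1) by (rule diff_times_mono) auto
  have "(deriv ^^ Suc k) (\<lambda>x. f (a + b * x)) x = deriv (\<lambda>x. b ^ k * (deriv ^^ k) f (a + b * x)) x"
    using deriv_cong_open[OF assms(1) Suc.prems(2) Suc.IH[OF D]] by (simp only: funpow.simps o_apply)
  also have "((deriv ^^ k) f has_field_derivative (deriv ^^ Suc k) f (a + b * x)) (at (a + b * x))"
    by (rule diff_times_has_iterated_deriv[OF Suc.prems(1)]) (use assms Suc.prems in auto)
  then have "((\<lambda>x. (deriv ^^ k) f (a + b * x)) has_field_derivative (deriv ^^ Suc k) f (a + b * x) * b) (at x)"
    by (rule DERIV_chain2) (auto intro!: derivative_eq_intros)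
  then have "((\<lambda>x. b ^ k * (deriv ^^ k) f (a + b * x)) has_field_derivative
       b ^ k * ((deriv ^^ Suc k) f (a + b * x) * b)) (at x)"
    by (rule DERIV_cmult)
  then have "deriv (\<lambda>x. b ^ k * (deriv ^^ k) f (a + b * x)) x =
       b ^ k * ((deriv ^^ Suc k) f (a + b * x) * b)"
    by (rule DERIV_imp_deriv)
  finally show ?case by simp
qed simp

lemma iterated_deriv_lincomb:
  assumes "open S" "diff_times k S f" "diff_times k S g" "x \<in> S"
  shows "(deriv ^^ k) (\<lambda>x. a * f x + b * g x) x = a * (deriv ^^ k) f x + b * (deriv ^^ k) g x"
  using assms(2,3,4)
proof (induction k arbitrary: x)
  case (Suc k)
  have D: "diff_times k S f" "diff_times k S g"
    using diff_times_mono[OF Suc.prems(1), of k S] diff_times_mono[OF Suc.prems(2), of k S] by auto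
  have "(deriv ^^ Suc k) (\<lambda>x. a * f x + b * g x) x =
      deriv (\<lambda>x. a * (deriv ^^ k) f x + b * (deriv ^^ k) g x) x"
    using deriv_cong_open[OF assms(1) Suc.prems(3) Suc.IH[OF D]] by (simp only: funpow.simps o_apply)
  also have "((deriv ^^ k) f has_field_derivative (deriv ^^ Suc k) f x) (at x)"
    "((deriv ^^ k) g has_field_derivative (deriv ^^ Suc k) g x) (at x)"
    using diff_times_has_iterated_deriv[of "Suc k" S _ x k] Suc.prems by blast+
  then have "((\<lambda>x. a * (deriv ^^ k) f x + b * (deriv ^^ k) g x) has_field_derivative
       a * (deriv ^^ Suc k) f x + b * (deriv ^^ Suc k) g x) (at x)"
    by (intro DERIV_add DERIV_cmult)
  then have "deriv (\<lambda>x. a * (deriv ^^ k) f x + b * (deriv ^^ k) g x) x =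
       a * (deriv ^^ Suc k) f x + b * (deriv ^^ Suc k) g x"
    by (rule DERIV_imp_deriv)
  finally show ?case by simp
qed simp

text \<open>Term-by-term differentiation. Only the decay in \<open>i\<close> has to be uniform on \<open>S\<close>; the constant may
  depend on the order \<open>k\<close>. The lemma is used both to build curves out of infinitely many bumps and to
  pass to the limit in difference quotients.\<close>

lemma diff_times_suminf:
  fixes w :: "nat \<Rightarrow> real \<Rightarrow> real"
  assumes "open S" "convex S"
    and "\<And>i. diff_times p S (w i)"
    and "\<And>k. k \<le> p \<Longrightarrow> \<exists>C. \<forall>i. \<forall>x\<in>S. \<bar>(deriv ^^ k) (w i) x\<bar> \<le> C * (1/2) ^ i"
  shows "diff_times p S (\<lambda>x. \<Sum>i. w i x)"
  using assms(3,4)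
proof (induction p arbitrary: w)
  case (Suc p)
  show ?case
  proof (rule diff_times_SucI[OF assms(1), where f' = "\<lambda>x. \<Sum>i. deriv (w i) x"])
    show "diff_times p S (\<lambda>x. \<Sum>i. deriv (w i) x)"
    proof (rule Suc.IH)
      fix k assume "k \<le> p"
      then show "\<exists>C. \<forall>i. \<forall>x\<in>S. \<bar>(deriv ^^ k) (deriv (w i)) x\<bar> \<le> C * (1/2) ^ i"
        using Suc.prems(2)[of "Suc k"] by (simp add: funpow_Suc_right del: funpow.simps)
    qed (use Suc.prems in auto)
    fix x assume x: "x \<in> S"
    obtain C0 where C0: "\<And>i x. x \<in> S \<Longrightarrow> \<bar>w i x\<bar> \<le> C0 * (1/2) ^ i"
      using Suc.prems(2)[of 0] by auto
    obtain C1 where C1: "\<And>i x. x \<in> S \<Longrightarrow> \<bar>deriv (w i) x\<bar> \<le> C1 * (1/2) ^ i"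
      using Suc.prems(2)[of 1] by auto
    show "((\<lambda>x. \<Sum>i. w i x) has_field_derivative (\<Sum>i. deriv (w i) x)) (at x)"
    proof (rule has_field_derivative_series'(2)[OF assms(2)])
      show "(w i has_field_derivative deriv (w i) x) (at x within S)" if "x \<in> S" for i x
        by (rule has_field_derivative_at_within[OF diff_times_has_deriv[OF Suc.prems(1) that]])
      show "uniformly_convergent_on S (\<lambda>n x. \<Sum>i<n. deriv (w i) x)"
        by (rule Weierstrass_m_test'[where M = "\<lambda>i. C1 * (1/2) ^ i"])
          (auto intro!: C1 summable_mult summable_geometric)
      show "summable (\<lambda>i. w i x)"
        by (rule summable_comparison_test'[where g = "\<lambda>i. C0 * (1/2) ^ i" and N = 0])
          (auto intro!: C0 x summable_mult summable_geometric)
      show "x \<in> S" "x \<in> interior S"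
        using x assms(1) by (auto simp: interior_open)
    qed
  qed
qed simp

section \<open>A smooth plateau function\<close>

text \<open>The factor \<open>x\<^sup>-\<^sup>k\<close> makes the family closed under differentiation, so that all orders are
  reached by one induction.\<close>

definition flat :: "nat \<Rightarrow> real \<Rightarrow> real" where
  "flat k x = (if x > 0 then exp (- 1 / x) / x ^ k else 0)"

lemma flat_tendsto_0: "(flat k \<longlongrightarrow> 0) (at 0)"
proof -
  have "((\<lambda>y::real. y ^ k / exp y) \<longlongrightarrow> 0) at_top"
    by (rule tendsto_power_div_exp_0)
  then have "((\<lambda>x::real. inverse x ^ k / exp (inverse x)) \<longlongrightarrow> 0) (at_right 0)"
    by (rule filterlim_compose[OF _ filterlim_inverse_at_top_right])
  moreover have "\<forall>\<^sub>F x::real in at_right 0. inverse x ^ k / exp (inverse x) = flat k x"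
    using eventually_at_right_less[of "0::real"]
    by eventually_elim (simp add: flat_def exp_minus field_simps)
  ultimately have "(flat k \<longlongrightarrow> 0) (at_right 0)"
    by (rule Lim_transform_eventually)
  moreover have "(flat k \<longlongrightarrow> 0) (at_left 0)"
  proof (rule Lim_transform_eventually[OF tendsto_const])
    show "\<forall>\<^sub>F x::real in at_left 0. 0 = flat k x"
      by (auto simp: flat_def eventually_at_filter)
  qed
  ultimately show ?thesis
    by (simp add: filterlim_at_split)
qed

lemma DERIV_flat: "(flat k has_field_derivative flat (k + 2) x - real k * flat (k + 1) x) (at x)"
proof (cases x "0 :: real" rule: linorder_cases)
  case less
  have "((\<lambda>_. 0) has_field_derivative 0) (at x)"
    by simp
  then have "(flat k has_field_derivative 0) (at x)"
    by (rule has_field_derivative_transform_within_open[where S = "{..<0}"])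
      (use less in \<open>auto simp: flat_def\<close>)
  then show ?thesis
    using less by (simp add: flat_def)
next
  case equal
  have "(\<lambda>h. (flat k (0 + h) - flat k 0) / h) = flat (k + 1)"
    by (auto simp: flat_def fun_eq_iff)
  then have "(flat k has_field_derivative 0) (at 0)"
    unfolding DERIV_def using flat_tendsto_0[of "k + 1"] by simp
  then show ?thesis
    using equal by (simp add: flat_def)
next
  case greater
  have "((\<lambda>x. exp (- 1 / x) / x ^ k) has_field_derivative
      (exp (- 1 / x) * (1 / x\<^sup>2) * x ^ k - exp (- 1 / x) * (real k * x ^ (k - 1))) / (x ^ k * x ^ k)) (at x)"
    using greater by (auto intro!: derivative_eq_intros simp: power2_eq_square)
  also have "(exp (- 1 / x) * (1 / x\<^sup>2) * x ^ k - exp (- 1 / x) * (real k * x ^ (k - 1))) / (x ^ k * x ^ k)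
      = flat (k + 2) x - real k * flat (k + 1) x"
    using greater by (cases k) (simp_all add: flat_def field_simps power2_eq_square)
  finally show ?thesis
    by (rule has_field_derivative_transform_within_open[where S = "{0<..}"])
      (use greater in \<open>auto simp: flat_def\<close>)
qed

lemma diff_times_flat: "diff_times m UNIV (flat k)"
proof (induction m arbitrary: k)
  case (Suc m)
  show ?case
    by (rule diff_times_SucI[OF _ DERIV_flat])
      (auto intro!: diff_times_diff diff_times_cmult Suc)
qed simp

text \<open>The inner function vanishes for \<open>|t| \<le> 1\<close> and exceeds \<open>1/4\<close> for \<open>|t| \<ge> 2\<close>; the outer one turns
  the first region into a plateau and kills the second. A composition avoids the usual quotient or
  integral.\<close>

definition plateau :: "real \<Rightarrow> real" where
  "plateau t = exp 1 * flat 0 (1 - 4 * flat 0 (t * t - 1))"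

lemma diff_times_plateau: "diff_times k UNIV plateau"
proof -
  have "diff_times k UNIV (\<lambda>t. flat 0 (t * t - 1))"
    using diff_times_mult[OF open_UNIV diff_times_ident[OF open_UNIV] diff_times_ident[OF open_UNIV]]
    by (intro diff_times_compose[OF _ diff_times_flat] diff_times_diff diff_times_const) auto
  then have "diff_times k UNIV (\<lambda>t. flat 0 (1 - 4 * flat 0 (t * t - 1)))"
    by (intro diff_times_compose[where f = "flat 0" and g = "\<lambda>t. 1 - 4 * flat 0 (t * t - 1)",
          OF _ diff_times_flat]) (auto intro!: diff_times_diff diff_times_cmult diff_times_const)
  then show ?thesis
    unfolding plateau_def[abs_def] by (intro diff_times_cmult) auto
qed

lemma plateau_bounds: "0 \<le> plateau t" "plateau t \<le> 1"
proof -
  have "flat 0 u \<le> exp (- 1)" if "u \<le> 1" for u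
    using that by (auto simp: flat_def field_simps)
  then have "flat 0 (1 - 4 * flat 0 (t * t - 1)) \<le> exp (- 1)"
    by (simp add: flat_def)
  then have "plateau t \<le> exp 1 * exp (- 1)"
    unfolding plateau_def by (intro mult_left_mono) auto
  then show "plateau t \<le> 1"
    by (simp flip: exp_add)
qed (simp add: plateau_def flat_def)

lemma plateau_eq_1: "\<bar>t\<bar> \<le> 1 \<Longrightarrow> plateau t = 1"
proof -
  assume "\<bar>t\<bar> \<le> 1"
  then have "t * t \<le> 1"
    by (simp add: abs_square_le_1 flip: power2_eq_square)
  then show ?thesis
    by (simp add: plateau_def flat_def flip: exp_add)
qed

lemma plateau_eq_0: "2 \<le> \<bar>t\<bar> \<Longrightarrow> plateau t = 0"
proof -
  assume t: "2 \<le> \<bar>t\<bar>"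
  have "2 * 2 \<le> \<bar>t\<bar> * \<bar>t\<bar>"
    using t by (intro mult_mono) auto
  then have "t * t - 1 \<ge> 3"
    by simp
  then have "flat 0 (t * t - 1) = exp (- 1 / (t * t - 1))" "- 1 / (t * t - 1) \<ge> - 1 / 3"
    by (auto simp: flat_def field_simps)
  moreover have "exp (- 1 / (t * t - 1)) \<ge> 1 + (- 1 / (t * t - 1))"
    by (rule exp_ge_add_one_self)
  ultimately show ?thesis
    by (simp add: plateau_def flat_def)
qed

section \<open>Interpolation of derivatives\<close>

text \<open>Here \<open>M k\<close> stands for the supremum of the \<open>k\<close>-th derivative and \<open>r\<close> for a length scale. In the
  scale-free quantities \<open>r^k M k\<close> a derivative is bounded by the function itself and an arbitrarily
  small multiple of the next derivative. The small factor \<open>\<epsilon>\<close> is what makes the induction run: the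
  term of the same order that reappears on the right is absorbed on the left. The constant depends
  only on \<open>\<epsilon>\<close> and \<open>m\<close>, so the sequence and the scale are quantified inside.\<close>

lemma landau_sequence_step:
  fixes \<epsilon> :: real
  assumes "0 < \<epsilon>"
  shows "\<exists>C\<ge>0. \<forall>(M :: nat \<Rightarrow> real) L r. (\<forall>k. M k \<ge> 0) \<longrightarrow>
      (\<forall>k r. 0 < r \<longrightarrow> r \<le> L \<longrightarrow> M (Suc k) \<le> 2 * M k / r + r * M (Suc (Suc k))) \<longrightarrow>
      0 < r \<longrightarrow> r \<le> L \<longrightarrow> r ^ m * M m \<le> C * M 0 + \<epsilon> * (r ^ Suc m * M (Suc m))"
  using assms
proof (induction m arbitrary: \<epsilon>)
  case 0
  show ?case
    by (rule exI[of _ 1]) (use 0 in auto)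
next
  case (Suc m)
  define \<theta> where "\<theta> = min 1 (\<epsilon> / 2)"
  have \<theta>: "0 < \<theta>" "\<theta> \<le> 1" "2 * \<theta> \<le> \<epsilon>"
    using Suc.prems by (auto simp: \<theta>_def)
  obtain C :: real where C: "C \<ge> 0" "\<And>M L r. (\<forall>k. M k \<ge> 0) \<Longrightarrow>
      (\<forall>k r. 0 < r \<longrightarrow> r \<le> L \<longrightarrow> M (Suc k) \<le> 2 * M k / r + r * M (Suc (Suc k))) \<Longrightarrow>
      0 < r \<Longrightarrow> r \<le> L \<Longrightarrow> r ^ m * M m \<le> C * M 0 + (\<theta> / 4) * (r ^ Suc m * M (Suc m))"
    using Suc.IH[of "\<theta> / 4"] \<theta> by auto
  show ?case
  proof (intro exI[of _ "4 * C / \<theta>"] conjI allI impI)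
    show "4 * C / \<theta> \<ge> 0"
      using C \<theta> by auto
    fix M :: "nat \<Rightarrow> real" and L r :: real
    assume M: "\<forall>k. M k \<ge> 0"
      "\<forall>k r. 0 < r \<longrightarrow> r \<le> L \<longrightarrow> M (Suc k) \<le> 2 * M k / r + r * M (Suc (Suc k))"
      and r: "0 < r" "r \<le> L"
    \<comment> \<open>The inequality is applied at the smaller scale \<open>\<theta> r\<close>; then \<open>2 / \<theta> * (\<theta> / 4) = 1 / 2\<close> allows absorption.\<close>
    define a where "a = r ^ m * M m"
    define b where "b = r ^ Suc m * M (Suc m)"
    define c where "c = r ^ Suc (Suc m) * M (Suc (Suc m))"
    have "0 \<le> c"
      using M(1) r by (auto simp: c_def)
    have IH: "a \<le> C * M 0 + \<theta> / 4 * b"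
      unfolding a_def b_def by (rule C(2)[OF M r])
    have "\<theta> * r \<le> L"
      using mult_right_mono[of \<theta> 1 r] r \<theta> by linarith
    then have "M (Suc m) \<le> 2 * M m / (\<theta> * r) + \<theta> * r * M (Suc (Suc m))"
      using M(2)[rule_format, of "\<theta> * r" m] r \<theta>(1) by simp
    then have "b \<le> r ^ Suc m * (2 * M m / (\<theta> * r) + \<theta> * r * M (Suc (Suc m)))"
      unfolding b_def using r by (intro mult_left_mono) auto
    also have "\<dots> = 2 / \<theta> * a + \<theta> * c"
      using r \<theta> by (simp add: a_def c_def field_simps)
    also have "\<dots> \<le> 2 / \<theta> * (C * M 0 + \<theta> / 4 * b) + \<theta> * c"
      using IH \<theta> by (intro add_right_mono mult_left_mono) auto
    also have "\<dots> = 2 * C / \<theta> * M 0 + b / 2 + \<theta> * c"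
      using \<theta> by (simp add: field_simps)
    finally have "b \<le> 4 * C / \<theta> * M 0 + 2 * \<theta> * c"
      by (simp add: field_simps)
    also have "\<dots> \<le> 4 * C / \<theta> * M 0 + \<epsilon> * c"
      using \<theta>(3) \<open>0 \<le> c\<close> by (intro add_left_mono mult_right_mono)
    finally show "r ^ Suc m * M (Suc m) \<le> 4 * C / \<theta> * M 0 + \<epsilon> * (r ^ Suc (Suc m) * M (Suc (Suc m)))"
      unfolding b_def c_def .
  qed
qed

lemma landau_sequence:
  assumes "k \<le> N"
  shows "\<exists>C\<ge>0. \<forall>(M :: nat \<Rightarrow> real) L r. (\<forall>k. M k \<ge> 0) \<longrightarrow>
      (\<forall>k r. 0 < r \<longrightarrow> r \<le> L \<longrightarrow> M (Suc k) \<le> 2 * M k / r + r * M (Suc (Suc k))) \<longrightarrow>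
      0 < r \<longrightarrow> r \<le> L \<longrightarrow> r ^ k * M k \<le> C * (M 0 + r ^ N * M N)"
  using assms
proof (induction k rule: inc_induct)
  case base
  show ?case
    by (rule exI[of _ 1]) auto
next
  case (step k)
  obtain C :: real where C: "C \<ge> 0" "\<And>M L r. (\<forall>k. M k \<ge> 0) \<Longrightarrow>
      (\<forall>k r. 0 < r \<longrightarrow> r \<le> L \<longrightarrow> M (Suc k) \<le> 2 * M k / r + r * M (Suc (Suc k))) \<Longrightarrow>
      0 < r \<Longrightarrow> r \<le> L \<Longrightarrow> r ^ Suc k * M (Suc k) \<le> C * (M 0 + r ^ N * M N)"
    using step.IH by auto
  obtain D :: real where D: "D \<ge> 0" "\<And>M L r. (\<forall>k. M k \<ge> 0) \<Longrightarrow>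
      (\<forall>k r. 0 < r \<longrightarrow> r \<le> L \<longrightarrow> M (Suc k) \<le> 2 * M k / r + r * M (Suc (Suc k))) \<Longrightarrow>
      0 < r \<Longrightarrow> r \<le> L \<Longrightarrow> r ^ k * M k \<le> D * M 0 + 1 * (r ^ Suc k * M (Suc k))"
    using landau_sequence_step[of 1 k] by auto
  show ?case
  proof (intro exI[of _ "D + C"] conjI allI impI)
    show "D + C \<ge> 0"
      using C D by auto
    fix M :: "nat \<Rightarrow> real" and L r :: real
    assume M: "\<forall>k. M k \<ge> 0"
      "\<forall>k r. 0 < r \<longrightarrow> r \<le> L \<longrightarrow> M (Suc k) \<le> 2 * M k / r + r * M (Suc (Suc k))"
      and r: "0 < r" "r \<le> L"
    have "r ^ k * M k \<le> D * M 0 + C * (M 0 + r ^ N * M N)"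
      using D(2)[OF M r] C(2)[OF M r] by simp
    also have "\<dots> \<le> D * (M 0 + r ^ N * M N) + C * (M 0 + r ^ N * M N)"
      using M(1) r D(1) by (intro add_right_mono mult_left_mono) auto
    finally show "r ^ k * M k \<le> (D + C) * (M 0 + r ^ N * M N)"
      by (simp add: algebra_simps)
  qed
qed

lemma mean_value_unordered:
  fixes f f' :: "real \<Rightarrow> real"
  assumes "\<And>z. min x y \<le> z \<Longrightarrow> z \<le> max x y \<Longrightarrow> (f has_field_derivative f' z) (at z)"
  shows "\<exists>z. min x y \<le> z \<and> z \<le> max x y \<and> f y - f x = (y - x) * f' z"
proof (cases x y rule: linorder_cases)
  case less
  then obtain z where "x < z" "z < y" "f y - f x = (y - x) * f' z"
    using MVT2[of x y f f'] assms by auto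
  then show ?thesis
    using less by (intro exI[of _ z]) auto
next
  case greater
  then obtain z where "y < z" "z < x" "f x - f y = (x - y) * f' z"
    using MVT2[of y x f f'] assms by auto
  then show ?thesis
    using greater by (intro exI[of _ z]) (auto simp: algebra_simps)
qed auto

text \<open>One of \<open>x + r\<close>, \<open>x - r\<close> stays in the interval. The mean value theorem gives a point within
  distance \<open>r\<close> of \<open>x\<close> where \<open>u'\<close> is at most \<open>2 * A / r\<close>, and \<open>u'\<close> changes by at most \<open>r * B\<close> on
  the way to \<open>x\<close>.\<close>

lemma landau_inequality:
  fixes u u' u'' :: "real \<Rightarrow> real"
  assumes u: "\<And>z. z \<in> {a..b} \<Longrightarrow> (u has_field_derivative u' z) (at z)"
    and u': "\<And>z. z \<in> {a..b} \<Longrightarrow> (u' has_field_derivative u'' z) (at z)"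
    and A: "\<And>z. z \<in> {a..b} \<Longrightarrow> \<bar>u z\<bar> \<le> A"
    and B: "\<And>z. z \<in> {a..b} \<Longrightarrow> \<bar>u'' z\<bar> \<le> B"
    and r: "0 < r" "2 * r \<le> b - a" and x: "x \<in> {a..b}"
  shows "\<bar>u' x\<bar> \<le> 2 * A / r + r * B"
proof -
  obtain y where y: "y \<in> {a..b}" "\<bar>y - x\<bar> = r"
  proof (cases "x + r \<le> b")
    case True
    with x r that[of "x + r"] show ?thesis by auto
  next
    case False
    with x r that[of "x - r"] show ?thesis by auto
  qed
  have sub: "z \<in> {a..b}" if "min x y \<le> z" "z \<le> max x y" for z
    using that x y(1) by auto
  obtain z where z: "min x y \<le> z" "z \<le> max x y" "u y - u x = (y - x) * u' z"
    using mean_value_unordered[of x y u u'] u sub by blast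
  have sub': "w \<in> {a..b}" if "min x z \<le> w" "w \<le> max x z" for w
    using that x sub[OF z(1,2)] by auto
  obtain w where w: "min x z \<le> w" "w \<le> max x z" "u' z - u' x = (z - x) * u'' w"
    using mean_value_unordered[of x z u' u''] u' sub' by blast
  have "r * \<bar>u' z\<bar> = \<bar>u y - u x\<bar>"
    using z(3) y(2) by (simp add: abs_mult)
  also have "\<dots> \<le> 2 * A"
    using A[OF x] A[OF y(1)] by linarith
  finally have "\<bar>u' z\<bar> \<le> 2 * A / r"
    using r by (simp add: field_simps)
  moreover have "\<bar>u' z - u' x\<bar> \<le> r * B"
    unfolding w(3) abs_mult
    using B[OF sub'[OF w(1,2)]] z(1,2) y(2) r by (intro mult_mono) auto
  ultimately show ?thesis
    by linarith
qed

text \<open>The Landau-Kolmogorov inequality in additive form. The constant depends on the orders and the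
  interval only, not on \<open>g\<close> or on the scale \<open>r\<close>, which is later chosen to balance the two terms.\<close>

lemma derivative_interpolation:
  fixes a b :: real
  assumes "k \<le> N" "a < b"
  shows "\<exists>C\<ge>0. \<forall>g S A B r. (\<forall>j. diff_times j S g) \<longrightarrow> {a..b} \<subseteq> S \<longrightarrow>
      (\<forall>x\<in>{a..b}. \<bar>g x\<bar> \<le> A) \<longrightarrow> (\<forall>x\<in>{a..b}. \<bar>(deriv ^^ N) g x\<bar> \<le> B) \<longrightarrow>
      0 < r \<longrightarrow> 2 * r \<le> b - a \<longrightarrow> (\<forall>x\<in>{a..b}. r ^ k * \<bar>(deriv ^^ k) g x\<bar> \<le> C * (A + r ^ N * B))"
proof -
  obtain C :: real where C: "C \<ge> 0" "\<And>M L r. (\<forall>k. M k \<ge> 0) \<Longrightarrow>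
      (\<forall>k r. 0 < r \<longrightarrow> r \<le> L \<longrightarrow> M (Suc k) \<le> 2 * M k / r + r * M (Suc (Suc k))) \<Longrightarrow>
      0 < r \<Longrightarrow> r \<le> L \<Longrightarrow> r ^ k * M k \<le> C * (M 0 + r ^ N * M N)"
    using landau_sequence[OF assms(1)] by auto
  show ?thesis
  proof (intro exI[of _ C] conjI allI impI ballI C(1))
    fix g S A B r x
    assume g: "\<forall>j. diff_times j S g" and S: "{a..b} \<subseteq> S"
      and A: "\<forall>x\<in>{a..b}. \<bar>g x\<bar> \<le> A" and B: "\<forall>x\<in>{a..b}. \<bar>(deriv ^^ N) g x\<bar> \<le> B"
      and r: "0 < r" "2 * r \<le> b - a" and x: "x \<in> {a..b}"
    define M where "M k = (SUP x\<in>{a..b}. \<bar>(deriv ^^ k) g x\<bar>)" for k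
    have bdd: "bdd_above ((\<lambda>x. \<bar>(deriv ^^ k) g x\<bar>) ` {a..b})" for k
    proof -
      have "continuous_on {a..b} ((deriv ^^ k) g)"
        using continuous_on_iterated_deriv[of "Suc k" S g k] g S continuous_on_subset by blast
      then have "continuous_on {a..b} (\<lambda>x. \<bar>(deriv ^^ k) g x\<bar>)"
        by (intro continuous_intros)
      then show ?thesis
        by (intro bounded_imp_bdd_above compact_imp_bounded compact_continuous_image) auto
    qed
    have le_M: "\<bar>(deriv ^^ k) g z\<bar> \<le> M k" if "z \<in> {a..b}" for k z
      unfolding M_def by (rule cSUP_upper[OF that bdd])
    have M_le: "M k \<le> c" if "\<And>z. z \<in> {a..b} \<Longrightarrow> \<bar>(deriv ^^ k) g z\<bar> \<le> c" for k c
      unfolding M_def by (rule cSUP_least) (use assms that in auto)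
    have M0: "M k \<ge> 0" for k
      using le_M[OF x, of k] by linarith
    have D: "((deriv ^^ k) g has_field_derivative (deriv ^^ Suc k) g z) (at z)" if "z \<in> {a..b}" for k z
      using diff_times_has_iterated_deriv[of "Suc k" S g z k] g S that by blast
    have "M (Suc k) \<le> 2 * M k / s + s * M (Suc (Suc k))" if "0 < s" "s \<le> (b - a) / 2" for k s
      by (rule M_le, rule landau_inequality[where u = "(deriv ^^ k) g", OF D D le_M le_M])
        (use that in auto)
    then have M_k: "r ^ k * M k \<le> C * (M 0 + r ^ N * M N)"
      by (intro C(2)[where L = "(b - a) / 2"]) (use M0 r in auto)
    have "r ^ k * \<bar>(deriv ^^ k) g x\<bar> \<le> r ^ k * M k"
      using le_M[OF x] r by (intro mult_left_mono) auto
    also note M_k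
    also have "C * (M 0 + r ^ N * M N) \<le> C * (A + r ^ N * B)"
      using M_le[of 0 A] M_le[of N B] A B r C(1) by (intro mult_left_mono add_mono) auto
    finally show "r ^ k * \<bar>(deriv ^^ k) g x\<bar> \<le> C * (A + r ^ N * B)" .
  qed
qed

section \<open>Boxes in coordinate space\<close>

text \<open>Cubes in the first \<open>n\<close> coordinates, intersected with the model space, form a neighbourhood base
  that allows changing one coordinate at a time.\<close>

definition coord_box :: "nat \<Rightarrow> (nat \<Rightarrow> real) \<Rightarrow> real \<Rightarrow> (nat \<Rightarrow> real) set" where
  "coord_box n x \<epsilon> = {y \<in> topspace (Euclidean_space n). \<forall>j<n. \<bar>y j - x j\<bar> < \<epsilon>}"

lemma coord_boxI:
  "(\<And>j. j < n \<Longrightarrow> \<bar>y j - x j\<bar> < \<epsilon>) \<Longrightarrow> (\<And>j. n \<le> j \<Longrightarrow> y j = 0) \<Longrightarrow> y \<in> coord_box n x \<epsilon>"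
  by (auto simp: coord_box_def topspace_Euclidean_space)

lemma coord_boxD: "y \<in> coord_box n x \<epsilon> \<Longrightarrow> j < n \<Longrightarrow> \<bar>y j - x j\<bar> < \<epsilon>"
  by (auto simp: coord_box_def)

lemma coord_box_zero: "y \<in> coord_box n x \<epsilon> \<Longrightarrow> n \<le> j \<Longrightarrow> y j = 0"
  by (auto simp: coord_box_def topspace_Euclidean_space)

lemma coord_box_mono: "\<epsilon> \<le> \<delta> \<Longrightarrow> coord_box n x \<epsilon> \<subseteq> coord_box n x \<delta>"
  by (force simp: coord_box_def)

lemma coord_box_center: "x \<in> topspace (Euclidean_space n) \<Longrightarrow> 0 < \<epsilon> \<Longrightarrow> x \<in> coord_box n x \<epsilon>"
  by (auto simp: coord_box_def)

lemma coord_box_upd: "y \<in> coord_box n x \<epsilon> \<Longrightarrow> i < n \<Longrightarrow> \<bar>t - x i\<bar> < \<epsilon> \<Longrightarrow> y(i := t) \<in> coord_box n x \<epsilon>"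
  by (auto simp: coord_box_def topspace_Euclidean_space)

lemma openin_coord_box: "openin (Euclidean_space n) (coord_box n x \<epsilon>)"
proof -
  have "openin (Euclidean_space n) {y \<in> topspace (Euclidean_space n). y j - x j \<in> {-\<epsilon><..<\<epsilon>}}" for j
  proof (rule openin_continuous_map_preimage)
    have "continuous_map (Euclidean_space n) euclideanreal (\<lambda>y. y j)"
      unfolding Euclidean_space_def
      by (intro continuous_map_from_subtopology continuous_map_product_projection) auto
    then show "continuous_map (Euclidean_space n) euclideanreal (\<lambda>y. y j - x j)"
      by (intro continuous_map_diff) auto
  qed auto
  then have "openin (Euclidean_space n) (topspace (Euclidean_space n) \<inter>
      (\<Inter>j\<in>{..<n}. {y \<in> topspace (Euclidean_space n). y j - x j \<in> {-\<epsilon><..<\<epsilon>}}))"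
    by (intro openin_Int_Inter) auto
  moreover have "r \<in> {-\<epsilon><..<\<epsilon>} \<longleftrightarrow> \<bar>r\<bar> < \<epsilon>" for r :: real
    by (auto simp: abs_less_iff)
  then have "(topspace (Euclidean_space n) \<inter>
      (\<Inter>j\<in>{..<n}. {y \<in> topspace (Euclidean_space n). y j - x j \<in> {-\<epsilon><..<\<epsilon>}})) = coord_box n x \<epsilon>"
    by (auto simp: coord_box_def simp del: greaterThanLessThan_iff)
  ultimately show ?thesis by simp
qed

lemma openin_contains_coord_box:
  assumes "openin (Euclidean_space n) W" "x \<in> W"
  obtains \<epsilon> where "\<epsilon> > 0" "coord_box n x \<epsilon> \<subseteq> W"
proof -
  obtain U where U: "openin (powertop_real UNIV) U" "W = U \<inter> {x. \<forall>i\<ge>n. x i = 0}"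
    using assms(1) unfolding Euclidean_space_def openin_subtopology by blast
  then obtain A where A: "\<And>i. open (A i)" "x \<in> Pi\<^sub>E UNIV A" "Pi\<^sub>E UNIV A \<subseteq> U"
    using assms(2) by (simp add: openin_product_topology_alt) blast
  have "\<exists>e>0. \<forall>z. \<bar>z - x i\<bar> < e \<longrightarrow> z \<in> A i" for i
    using A(1)[of i] A(2) unfolding open_dist dist_real_def by auto
  then obtain e where e: "\<And>i. e i > 0" "\<And>i z. \<bar>z - x i\<bar> < e i \<Longrightarrow> z \<in> A i"
    by metis
  define \<epsilon> where "\<epsilon> = Min (insert 1 (e ` {..<n}))"
  have "\<epsilon> > 0"
    unfolding \<epsilon>_def using e(1) by (subst Min_gr_iff) auto
  have le: "\<epsilon> \<le> e j" if "j < n" for j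
    unfolding \<epsilon>_def using that by (intro Min_le) auto
  have "coord_box n x \<epsilon> \<subseteq> W"
  proof
    fix y assume y: "y \<in> coord_box n x \<epsilon>"
    have "y j \<in> A j" for j
    proof (cases "j < n")
      case True
      then show ?thesis
        using e(2) le coord_boxD[OF y] by fastforce
    next
      case False
      then have "y j = x j"
        using coord_box_zero[OF y] assms(2) U(2) by auto
      then show ?thesis
        using A(2) by auto
    qed
    then show "y \<in> W"
      using A(3) U(2) coord_box_zero[OF y] by auto
  qed
  with \<open>\<epsilon> > 0\<close> show thesis
    by (rule that)
qed

lemma continuous_map_coord_box_iff:
  assumes W: "openin (Euclidean_space n) W"
  shows "continuous_map (subtopology (Euclidean_space n) W) euclideanreal h \<longleftrightarrow>
     (\<forall>x\<in>W. \<forall>e>0. \<exists>\<delta>>0. \<forall>y\<in>coord_box n x \<delta> \<inter> W. \<bar>h y - h x\<bar> < e)" (is "?L \<longleftrightarrow> ?R")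
proof
  have top: "topspace (subtopology (Euclidean_space n) W) = W"
    using openin_subset[OF W] by auto
  show ?R if ?L
  proof (intro ballI allI impI)
    fix x and e :: real
    assume x: "x \<in> W" and e: "e > 0"
    have "openin (subtopology (Euclidean_space n) W) {y \<in> W. h y \<in> ball (h x) e}"
      using openin_continuous_map_preimage[OF \<open>?L\<close>, of "ball (h x) e"] unfolding top by simp
    then have "openin (Euclidean_space n) {y \<in> W. h y \<in> ball (h x) e}"
      using W by (simp add: openin_open_subtopology)
    moreover have "x \<in> {y \<in> W. h y \<in> ball (h x) e}"
      using x e by simp
    ultimately obtain \<delta> where "\<delta> > 0" "coord_box n x \<delta> \<subseteq> {y \<in> W. h y \<in> ball (h x) e}"
      by (rule openin_contains_coord_box)
    then show "\<exists>\<delta>>0. \<forall>y\<in>coord_box n x \<delta> \<inter> W. \<bar>h y - h x\<bar> < e"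
      by (intro exI[of _ \<delta>]) (auto simp: dist_real_def abs_minus_commute)
  qed
  show ?L if ?R
    unfolding continuous_map top
  proof (intro conjI allI impI)
    fix V :: "real set" assume "openin euclideanreal V"
    then have V: "open V" by simp
    have "openin (Euclidean_space n) {y \<in> W. h y \<in> V}"
    proof (subst openin_subopen, intro ballI)
      fix x assume x: "x \<in> {y \<in> W. h y \<in> V}"
      then obtain e where e: "e > 0" "\<And>z. \<bar>z - h x\<bar> < e \<Longrightarrow> z \<in> V"
        using V unfolding open_dist dist_real_def by auto
      obtain \<delta> where \<delta>: "\<delta> > 0" "\<And>y. y \<in> coord_box n x \<delta> \<inter> W \<Longrightarrow> \<bar>h y - h x\<bar> < e"
        using \<open>?R\<close> x e(1) by blast
      have "x \<in> coord_box n x \<delta>"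
        using x openin_subset[OF W] \<delta>(1) by (intro coord_box_center) auto
      then show "\<exists>T. openin (Euclidean_space n) T \<and> x \<in> T \<and> T \<subseteq> {y \<in> W. h y \<in> V}"
        using x \<delta>(2) e(2) W openin_coord_box by (intro exI[of _ "coord_box n x \<delta> \<inter> W"]) auto
    qed
    then show "openin (subtopology (Euclidean_space n) W) {y \<in> W. h y \<in> V}"
      using W by (simp add: openin_open_subtopology)
  qed auto
qed

section \<open>Functions that are smooth along smooth curves\<close>

definition smooth_curve :: "(nat \<Rightarrow> real) set \<Rightarrow> real set \<Rightarrow> (real \<Rightarrow> nat \<Rightarrow> real) \<Rightarrow> bool" where
  "smooth_curve W S c \<longleftrightarrow> c ` S \<subseteq> W \<and> (\<forall>j k. diff_times k S (\<lambda>t. c t j))"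

definition curve_smooth :: "(nat \<Rightarrow> real) set \<Rightarrow> ((nat \<Rightarrow> real) \<Rightarrow> real) \<Rightarrow> bool" where
  "curve_smooth W h \<longleftrightarrow> (\<forall>c k. smooth_curve W UNIV c \<longrightarrow> diff_times k UNIV (\<lambda>t. h (c t)))"

lemma smooth_curve_compose:
  assumes "open S" "smooth_curve W T c" "\<And>k. diff_times k S g" "g ` S \<subseteq> T"
  shows "smooth_curve W S (\<lambda>t. c (g t))"
  using assms diff_times_compose[OF assms(1) _ assms(3,4)] unfolding smooth_curve_def by blast

text \<open>The definition speaks of curves defined on the whole line. A locally defined curve is reduced to
  one of these by a smooth reparametrization \<open>\<kappa>\<close> that is the identity near \<open>t0\<close> and has its
  values in a small interval around \<open>t0\<close>.\<close>

lemma curve_smooth_local: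
  assumes h: "curve_smooth W h" and S: "open S" and c: "smooth_curve W S c"
  shows "diff_times k S (\<lambda>t. h (c t))"
proof (rule diff_times_local)
  fix t0 assume "t0 \<in> S"
  then obtain e where e: "e > 0" "\<And>t. \<bar>t - t0\<bar> < e \<Longrightarrow> t \<in> S"
    using S unfolding open_dist dist_real_def by auto
  define \<kappa> where "\<kappa> t = t0 + (t - t0) * plateau (2 / e * (t - t0))" for t
  have "\<kappa> t \<in> S" for t
  proof (rule e(2))
    show "\<bar>\<kappa> t - t0\<bar> < e"
    proof (cases "\<bar>t - t0\<bar> < e")
      case True
      have "\<bar>t - t0\<bar> * plateau (2 / e * (t - t0)) \<le> \<bar>t - t0\<bar> * 1"
        using plateau_bounds by (intro mult_left_mono) auto
      then show ?thesis
        using True plateau_bounds by (simp add: \<kappa>_def abs_mult)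
    next
      case False
      then have "2 \<le> \<bar>2 / e * (t - t0)\<bar>"
        using e(1) by (simp add: abs_mult field_simps)
      then show ?thesis
        using e(1) by (simp add: \<kappa>_def plateau_eq_0)
    qed
  qed
  moreover have "diff_times k UNIV (\<lambda>t. plateau (2 / e * (t - t0)))" for k
    by (intro diff_times_compose[where f = plateau, OF _ diff_times_plateau] diff_times_cmult
        diff_times_diff diff_times_ident diff_times_const) auto
  then have "diff_times k UNIV \<kappa>" for k
    unfolding \<kappa>_def[abs_def]
    by (intro diff_times_add diff_times_const diff_times_mult diff_times_diff diff_times_ident) auto
  ultimately have "smooth_curve W UNIV (\<lambda>t. c (\<kappa> t))"
    by (intro smooth_curve_compose[OF _ c]) auto
  then have "diff_times k UNIV (\<lambda>t. h (c (\<kappa> t)))"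
    using h by (auto simp: curve_smooth_def)
  then have "diff_times k {t0 - e / 2<..<t0 + e / 2} (\<lambda>t. h (c (\<kappa> t)))"
    by (rule diff_times_mono) auto
  then have "diff_times k {t0 - e / 2<..<t0 + e / 2} (\<lambda>t. h (c t))"
  proof (rule diff_times_cong[rotated])
    fix t assume "t \<in> {t0 - e / 2<..<t0 + e / 2}"
    then have "\<bar>2 / e * (t - t0)\<bar> \<le> 1"
      using e(1) by (simp add: abs_mult field_simps) linarith
    then show "h (c (\<kappa> t)) = h (c t)"
      by (simp add: \<kappa>_def plateau_eq_1)
  qed auto
  then show "\<exists>U. t0 \<in> U \<and> diff_times k U (\<lambda>t. h (c t))"
    using e(1) by (intro exI[of _ "{t0 - e / 2<..<t0 + e / 2}"]) auto
qed

lemma smooth_curve_line: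
  assumes "y \<in> coord_box n x \<epsilon>" "i < n"
  shows "smooth_curve (coord_box n x \<epsilon>) {x i - \<epsilon><..<x i + \<epsilon>} (\<lambda>t. y(i := t))"
  unfolding smooth_curve_def
proof (intro conjI allI)
  show "(\<lambda>t. y(i := t)) ` {x i - \<epsilon><..<x i + \<epsilon>} \<subseteq> coord_box n x \<epsilon>"
    using coord_box_upd[OF assms] by auto
  show "diff_times k {x i - \<epsilon><..<x i + \<epsilon>} (\<lambda>t. (y(i := t)) j)" for j k
    by (cases "j = i") (auto intro: diff_times_ident diff_times_const)
qed

lemma smooth_curve_mono: "smooth_curve V S c \<Longrightarrow> V \<subseteq> W \<Longrightarrow> smooth_curve W S c"
  by (auto simp: smooth_curve_def)

lemma curve_smooth_slice:
  assumes "curve_smooth W h" "coord_box n x \<epsilon> \<subseteq> W" "y \<in> coord_box n x \<epsilon>" "i < n"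
  shows "diff_times k {x i - \<epsilon><..<x i + \<epsilon>} (\<lambda>t. h (y(i := t)))"
  by (rule curve_smooth_local[OF assms(1) _ smooth_curve_mono[OF smooth_curve_line[OF assms(3,4)] assms(2)]])
    auto

lemma eventually_coord_box:
  assumes "\<And>j. continuous_on UNIV (\<lambda>s. c s j)" "\<And>s. c s \<in> topspace (Euclidean_space n)" "\<epsilon> > 0"
  shows "\<forall>\<^sub>F s in nhds s0. c s \<in> coord_box n (c s0) \<epsilon>"
proof -
  have "\<forall>\<^sub>F s in nhds s0. \<bar>c s j - c s0 j\<bar> < \<epsilon>" for j
  proof -
    have "open {s. \<bar>c s j - c s0 j\<bar> < \<epsilon>}"
      using assms(1) by (intro open_Collect_less continuous_intros)
    from eventually_nhds_in_open[OF this] show ?thesis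
      using assms(3) by simp
  qed
  then have "\<forall>\<^sub>F s in nhds s0. \<forall>j\<in>{..<n}. \<bar>c s j - c s0 j\<bar> < \<epsilon>"
    by (intro eventually_ball_finite) auto
  then show ?thesis
    by eventually_elim (use assms(2) in \<open>auto simp: coord_box_def\<close>)
qed

lemma smooth_curve_continuous: "smooth_curve W S c \<Longrightarrow> continuous_on S (\<lambda>s. c s j)"
  using continuous_on_iterated_deriv[of 1 S "\<lambda>s. c s j" 0] by (simp add: smooth_curve_def del: diff_times.simps)

section \<open>Local bounds for pure partial derivatives\<close>

lemma iterated_deriv_const: "(deriv ^^ k) (\<lambda>t. c) (x::real) = (if k = 0 then c else 0)"
proof (cases k)
  case (Suc j)
  have "(deriv ^^ j) (\<lambda>t. 0) = (\<lambda>t::real. 0::real)"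
    by (induction j) auto
  then show ?thesis
    unfolding Suc funpow_Suc_right by simp
qed simp

lemma bounded_iterated_deriv:
  assumes f: "\<And>k. diff_times k UNIV f" and 0: "\<And>t. R \<le> \<bar>t\<bar> \<Longrightarrow> f t = 0"
  shows "\<exists>C. \<forall>t. \<bar>(deriv ^^ k) f t\<bar> \<le> C"
proof -
  have "continuous_on UNIV ((deriv ^^ k) f)"
    by (rule continuous_on_iterated_deriv[OF f[of "Suc k"]]) simp
  then have "compact ((deriv ^^ k) f ` {-R..R})"
    by (intro compact_continuous_image) (auto intro: continuous_on_subset)
  then obtain C where C: "\<And>t. t \<in> {-R..R} \<Longrightarrow> \<bar>(deriv ^^ k) f t\<bar> \<le> C"
    by (meson bounded_real compact_imp_bounded imageI)
  have "\<bar>(deriv ^^ k) f t\<bar> \<le> max 0 C" for t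
  proof (cases "t \<in> {-R..R}")
    case True
    then show ?thesis using C by fastforce
  next
    case False
    have "(deriv ^^ k) f t = (deriv ^^ k) (\<lambda>t. 0) t"
      by (rule iterated_deriv_cong_open[of "- {-R..R}"]) (use False in \<open>auto intro!: 0\<close>)
    then show ?thesis
      by (simp add: iterated_deriv_const)
  qed
  then show ?thesis by blast
qed

text \<open>The factor \<open>a\<close> for the \<open>m\<close>-th function controls only its derivatives of order at most \<open>m\<close>. For
  a fixed order this leaves out finitely many \<open>m\<close>, which is harmless for summability; so no explicit
  estimates on the derivatives of the bumps are required.\<close>

lemma scale_derivatives:
  assumes "\<And>m k. \<exists>C. \<forall>t. \<bar>(deriv ^^ k) (f m) t\<bar> \<le> (C::real)"
  shows "\<exists>a. a > 0 \<and> (\<forall>k\<le>m. \<forall>t. a * \<bar>(deriv ^^ k) (f m) t\<bar> \<le> (1/2) ^ m)"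
proof -
  obtain C where C: "\<And>k t. \<bar>(deriv ^^ k) (f m) t\<bar> \<le> C k"
    using assms[of _ m] by metis
  define D where "D = 1 + (\<Sum>k\<le>m. \<bar>C k\<bar>)"
  have "D > 0"
    by (auto simp: D_def intro!: add_pos_nonneg sum_nonneg)
  have "\<bar>(deriv ^^ k) (f m) t\<bar> \<le> D" if "k \<le> m" for k t
  proof -
    have "\<bar>C k\<bar> \<le> (\<Sum>k\<le>m. \<bar>C k\<bar>)"
      using that by (intro member_le_sum) auto
    then show ?thesis
      using C[of k t] by (simp add: D_def)
  qed
  then have "(1/2) ^ m / D * \<bar>(deriv ^^ k) (f m) t\<bar> \<le> (1/2) ^ m / D * D" if "k \<le> m" for k t
    using that \<open>D > 0\<close> by (intro mult_left_mono) auto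
  then show ?thesis
    using \<open>D > 0\<close> by (intro exI[of _ "(1/2) ^ m / D"]) auto
qed

lemma diff_times_scaled_series:
  fixes f :: "nat \<Rightarrow> real \<Rightarrow> real"
  assumes f: "\<And>m k. diff_times k UNIV (f m)"
    and bdd: "\<And>m k. \<exists>C. \<forall>t. \<bar>(deriv ^^ k) (f m) t\<bar> \<le> C"
    and a: "\<And>m k t. k \<le> m \<Longrightarrow> a m * \<bar>(deriv ^^ k) (f m) t\<bar> \<le> (1/2) ^ m"
    and u: "\<And>m. \<bar>u m\<bar> \<le> a m"
  shows "diff_times k UNIV (\<lambda>t. \<Sum>m. u m * f m t)"
proof (rule diff_times_suminf)
  show "diff_times k UNIV (\<lambda>t. u m * f m t)" for m
    by (intro diff_times_cmult f) auto
  fix j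
  obtain C where C: "\<And>m t. \<bar>(deriv ^^ j) (f m) t\<bar> \<le> C m"
    using bdd[of j] by metis
  define D where "D = 1 + (\<Sum>m<j. 2 ^ m * (\<bar>u m\<bar> * \<bar>C m\<bar>))"
  have "\<bar>(deriv ^^ j) (\<lambda>t. u m * f m t) t\<bar> \<le> D * (1/2) ^ m" for m t
  proof -
    have "(deriv ^^ j) (\<lambda>t. u m * f m t + 0 * f m t) t = u m * (deriv ^^ j) (f m) t + 0 * (deriv ^^ j) (f m) t"
      by (rule iterated_deriv_lincomb[of UNIV]) (auto intro: f)
    then have eq: "\<bar>(deriv ^^ j) (\<lambda>t. u m * f m t) t\<bar> = \<bar>u m\<bar> * \<bar>(deriv ^^ j) (f m) t\<bar>"
      by (simp add: abs_mult)
    show ?thesis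
    proof (cases "j \<le> m")
      case True
      have "\<bar>u m\<bar> * \<bar>(deriv ^^ j) (f m) t\<bar> \<le> a m * \<bar>(deriv ^^ j) (f m) t\<bar>"
        using u by (intro mult_right_mono) auto
      also have "\<dots> \<le> 1 * (1/2) ^ m"
        using a[OF True] by simp
      also have "\<dots> \<le> D * (1/2) ^ m"
        unfolding D_def by (intro mult_right_mono) (auto intro!: sum_nonneg)
      finally show ?thesis
        unfolding eq .
    next
      case False
      have "\<bar>u m\<bar> * \<bar>(deriv ^^ j) (f m) t\<bar> \<le> \<bar>u m\<bar> * \<bar>C m\<bar>"
        using C[of m t] by (intro mult_left_mono) auto
      also have "\<dots> = (2 ^ m * (\<bar>u m\<bar> * \<bar>C m\<bar>)) * (1/2) ^ m"
        by (simp add: power_divide)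
      also have "\<dots> \<le> D * (1/2) ^ m"
      proof (intro mult_right_mono)
        have "2 ^ m * (\<bar>u m\<bar> * \<bar>C m\<bar>) \<le> (\<Sum>m<j. 2 ^ m * (\<bar>u m\<bar> * \<bar>C m\<bar>))"
          using False by (intro member_le_sum[where f = "\<lambda>m. 2 ^ m * (\<bar>u m\<bar> * \<bar>C m\<bar>)"]) auto
        then show "2 ^ m * (\<bar>u m\<bar> * \<bar>C m\<bar>) \<le> D"
          by (simp add: D_def)
      qed simp
      finally show ?thesis
        unfolding eq .
    qed
  qed
  then show "\<exists>C. \<forall>m. \<forall>x\<in>UNIV. \<bar>(deriv ^^ j) (\<lambda>t. u m * f m t) x\<bar> \<le> C * (1/2) ^ m"
    by blast
qed auto

lemma dyadic_intervals_disjoint: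
  fixes t :: real
  assumes "\<bar>t - (1/2) ^ m\<bar> < (1/2) ^ (m + 2)" "\<bar>t - (1/2) ^ l\<bar> < (1/2) ^ (l + 2)"
  shows "m = l"
proof -
  have False if "m < l" and t: "\<bar>t - (1/2) ^ m\<bar> < (1/2) ^ (m + 2)" "\<bar>t - (1/2) ^ l\<bar> < (1/2) ^ (l + 2)" for m l
  proof -
    have le: "(1/2::real) ^ l \<le> (1/2) ^ Suc m"
      using that(1) by (intro power_decreasing) auto
    have eq: "(1/2::real) ^ Suc m = 1/2 * (1/2) ^ m" "(1/2::real) ^ (m + 2) = 1/4 * (1/2) ^ m"
      "(1/2::real) ^ (l + 2) = 1/4 * (1/2) ^ l"
      by (simp_all add: power_add power2_eq_square)
    have "(0::real) < (1/2) ^ m"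
      by simp
    with le t show False
      unfolding eq abs_less_iff by linarith
  qed
  from this[of m l] this[of l m] assms show ?thesis
    by (metis linorder_neqE_nat)
qed

text \<open>If the bound fails, a smooth curve \<open>c\<close> contradicting smoothness of \<open>h \<circ> c\<close> is assembled from
  bumps \<open>b m\<close> with disjoint supports around the times \<open>\<tau> m = 2\<^sup>-\<^sup>m\<close>. Near \<open>\<tau> m\<close> the curve is
  exactly the line \<open>y m + a m (t - \<tau> m) e\<^sub>i\<close>, so the \<open>p\<close>-th derivative of \<open>h \<circ> c\<close> at \<open>\<tau> m\<close> is
  \<open>a m ^ p\<close> times that of the slice. The velocities \<open>a m\<close> are fixed first, small enough to make
  the sum of bumps smooth; then \<open>y m\<close> is picked within \<open>a m\<close> of \<open>x\<close> with a slice derivative so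
  large that the product still exceeds \<open>m\<close>.\<close>

lemma locally_bounded_slice_derivative:
  assumes W: "openin (Euclidean_space n) W" and h: "curve_smooth W h" and x: "x \<in> W" and i: "i < n"
  shows "\<exists>\<epsilon>>0. \<exists>K. coord_box n x \<epsilon> \<subseteq> W \<and>
    (\<forall>y\<in>coord_box n x \<epsilon>. \<bar>(deriv ^^ p) (\<lambda>t. h (y(i := t))) (y i)\<bar> \<le> K)"
proof (rule ccontr)
  define P where "P y = (deriv ^^ p) (\<lambda>t. h (y(i := t))) (y i)" for y
  assume "\<not> ?thesis"
  then have unbounded: "\<exists>y\<in>coord_box n x \<epsilon>. K < \<bar>P y\<bar>" if "\<epsilon> > 0" "coord_box n x \<epsilon> \<subseteq> W" for \<epsilon> K
    using that unfolding P_def by (meson not_le)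
  obtain \<epsilon> where \<epsilon>: "\<epsilon> > 0" "coord_box n x \<epsilon> \<subseteq> W"
    using openin_contains_coord_box[OF W x] .
  define \<tau> :: "nat \<Rightarrow> real" where "\<tau> m = (1/2) ^ m" for m
  define \<rho> :: "nat \<Rightarrow> real" where "\<rho> m = (1/2) ^ (m + 3)" for m
  have \<rho>: "0 < \<rho> m" "\<rho> m \<le> 1/8" for m
  proof -
    have "\<rho> m = (1/2) ^ m / 8"
      by (simp add: \<rho>_def power_add power3_eq_cube)
    moreover have "(1/2::real) ^ m \<le> 1"
      by (simp add: power_le_one)
    moreover have "(1/2::real) ^ m > 0"
      by simp
    ultimately show "0 < \<rho> m" "\<rho> m \<le> 1/8"
      by linarith+
  qed
  \<comment> \<open>\<open>b m\<close> shifts the curve to \<open>y m\<close>; \<open>b1 m\<close> provides the linear motion.\<close>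
  define b where "b m t = plateau (1 / \<rho> m * (t - \<tau> m))" for m t
  define b1 where "b1 m t = (t - \<tau> m) * b m t" for m t
  have b_smooth: "diff_times k UNIV (b m)" for k m
    unfolding b_def
    by (intro diff_times_compose[where f = plateau, OF _ diff_times_plateau] diff_times_cmult
        diff_times_diff diff_times_ident diff_times_const) auto
  then have b1_smooth: "diff_times k UNIV (b1 m)" for k m
    unfolding b1_def by (intro diff_times_mult diff_times_diff diff_times_ident diff_times_const) auto
  have b_eq_0: "b m t = 0" if "2 * \<rho> m \<le> \<bar>t - \<tau> m\<bar>" for m t
    unfolding b_def using that \<rho>[of m] by (intro plateau_eq_0) (simp add: abs_mult field_simps)
  have b_eq_1: "b m t = 1" if "\<bar>t - \<tau> m\<bar> \<le> \<rho> m" for m t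
    unfolding b_def using that \<rho>[of m] by (intro plateau_eq_1) (simp add: abs_mult field_simps)
  have b_le: "\<bar>b m t\<bar> \<le> 1" for m t
    using plateau_bounds by (simp add: b_def)
  have b1_le: "\<bar>b1 m t\<bar> \<le> 1" for m t
  proof (cases "2 * \<rho> m \<le> \<bar>t - \<tau> m\<bar>")
    case False
    then have "\<bar>t - \<tau> m\<bar> * \<bar>b m t\<bar> \<le> 1 * 1"
      using b_le[of m t] \<rho>[of m] by (intro mult_mono) auto
    then show ?thesis
      by (simp add: b1_def abs_mult)
  qed (simp add: b1_def b_eq_0)
  have far: "2 * \<rho> m \<le> \<bar>t - \<tau> m\<bar>" if "3 \<le> \<bar>t\<bar>" for m t
  proof -
    have "\<bar>\<tau> m\<bar> \<le> 1"
      by (simp add: \<tau>_def power_le_one)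
    then show ?thesis
      using that \<rho>[of m] by linarith
  qed
  have b_bdd: "\<exists>C. \<forall>t. \<bar>(deriv ^^ k) (b m) t\<bar> \<le> C" for k m
    by (rule bounded_iterated_deriv[OF b_smooth, of 3]) (auto intro!: b_eq_0 far)
  have b1_bdd: "\<exists>C. \<forall>t. \<bar>(deriv ^^ k) (b1 m) t\<bar> \<le> C" for k m
    by (rule bounded_iterated_deriv[OF b1_smooth, of 3]) (auto simp: b1_def intro!: b_eq_0 far)
  have "\<exists>a>0. a \<le> \<epsilon> / 4 \<and> (\<forall>k\<le>m. \<forall>t. a * \<bar>(deriv ^^ k) (b m) t\<bar> \<le> (1/2) ^ m) \<and>
      (\<forall>k\<le>m. \<forall>t. a * \<bar>(deriv ^^ k) (b1 m) t\<bar> \<le> (1/2) ^ m)" for m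
  proof -
    obtain a0 a1 where a: "a0 > 0" "\<And>k t. k \<le> m \<Longrightarrow> a0 * \<bar>(deriv ^^ k) (b m) t\<bar> \<le> (1/2) ^ m"
        "a1 > 0" "\<And>k t. k \<le> m \<Longrightarrow> a1 * \<bar>(deriv ^^ k) (b1 m) t\<bar> \<le> (1/2) ^ m"
      using scale_derivatives[of b, OF b_bdd] scale_derivatives[of b1, OF b1_bdd] by metis
    define a where "a = min (\<epsilon> / 4) (min a0 a1)"
    have "a \<le> a0" "a \<le> a1"
      by (auto simp: a_def)
    then have "a * \<bar>(deriv ^^ k) (b m) t\<bar> \<le> (1/2) ^ m" "a * \<bar>(deriv ^^ k) (b1 m) t\<bar> \<le> (1/2) ^ m"
      if "k \<le> m" for k t
      using order_trans[OF mult_right_mono a(2)[OF that]] order_trans[OF mult_right_mono a(4)[OF that]]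
      by auto
    moreover have "a > 0" "a \<le> \<epsilon> / 4"
      using \<epsilon>(1) a by (auto simp: a_def)
    ultimately show ?thesis by blast
  qed
  then obtain a where a: "\<And>m. a m > 0" "\<And>m. a m \<le> \<epsilon> / 4"
      "\<And>m k t. k \<le> m \<Longrightarrow> a m * \<bar>(deriv ^^ k) (b m) t\<bar> \<le> (1/2) ^ m"
      "\<And>m k t. k \<le> m \<Longrightarrow> a m * \<bar>(deriv ^^ k) (b1 m) t\<bar> \<le> (1/2) ^ m"
    by metis
  have "\<exists>y\<in>coord_box n x (a m). real m / a m ^ p < \<bar>P y\<bar>" for m
    using a(2)[of m] \<epsilon> coord_box_mono[of "a m" \<epsilon> n x] by (intro unbounded a) auto
  then obtain y where y: "\<And>m. y m \<in> coord_box n x (a m)" "\<And>m. real m / a m ^ p < \<bar>P (y m)\<bar>"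
    by metis
  define u where "u j m = y m j - x j" for j m
  define v where "v j m = (if j = i then a m else 0)" for j m
  have x0: "x j = 0" if "n \<le> j" for j
    using x openin_subset[OF W] that by (auto simp: topspace_Euclidean_space)
  have u: "\<bar>u j m\<bar> \<le> a m" for j m
  proof (cases "j < n")
    case True
    then show ?thesis
      using coord_boxD[OF y(1)] by (simp add: u_def less_imp_le)
  next
    case False
    then show ?thesis
      using x0[of j] coord_box_zero[OF y(1), of j m] a(1)[of m] by (simp add: u_def)
  qed
  have v: "\<bar>v j m\<bar> \<le> a m" for j m
    using a(1)[of m] by (simp add: v_def)
  define c where "c t j = x j + ((\<Sum>m. u j m * b m t) + (\<Sum>m. v j m * b1 m t))" for t j
  have c_smooth: "diff_times k UNIV (\<lambda>t. c t j)" for k j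
    unfolding c_def
    by (intro diff_times_add diff_times_const diff_times_scaled_series[where a = a] b_smooth b1_smooth
        b_bdd b1_bdd a u v) auto
  have c_eq: "c t j = x j + (u j m * b m t + v j m * b1 m t)" if "\<And>l. l \<noteq> m \<Longrightarrow> b l t = 0" for t j m
  proof -
    have "(\<Sum>m. u j m * b m t) = (\<Sum>m\<in>{m}. u j m * b m t)" "(\<Sum>m. v j m * b1 m t) = (\<Sum>m\<in>{m}. v j m * b1 m t)"
      by (intro suminf_finite; use that in \<open>auto simp: b1_def\<close>)+
    then show ?thesis
      by (simp add: c_def)
  qed
  have single: "b l t = 0" if "b m t \<noteq> 0" "l \<noteq> m" for l m t
  proof (rule ccontr)
    assume "b l t \<noteq> 0"
    then have "\<bar>t - \<tau> l\<bar> < 2 * \<rho> l" "\<bar>t - \<tau> m\<bar> < 2 * \<rho> m"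
      using b_eq_0[of l t] b_eq_0[of m t] that by (auto simp: not_le[symmetric])
    moreover have "2 * \<rho> k = (1/2) ^ (k + 2)" for k
      by (simp add: \<rho>_def power_add power3_eq_cube power2_eq_square)
    ultimately have "l = m"
      unfolding \<tau>_def by (intro dyadic_intervals_disjoint[of t l m]) simp_all
    then show False
      using that(2) by simp
  qed
  have c_box: "c t \<in> coord_box n x \<epsilon>" for t
  proof -
    \<comment> \<open>At most one bump is active at time \<open>t\<close>; if none is, any index serves.\<close>
    obtain m where m: "\<And>l. l \<noteq> m \<Longrightarrow> b l t = 0"
      using single by metis
    have c_m: "c t j = x j + (u j m * b m t + v j m * b1 m t)" for j
      by (rule c_eq) (rule m)
    show ?thesis
    proof (rule coord_boxI)
      fix j
      have "\<bar>c t j - x j\<bar> \<le> \<bar>u j m * b m t\<bar> + \<bar>v j m * b1 m t\<bar>"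
        using c_m[of j] by linarith
      also have "\<dots> \<le> a m * 1 + a m * 1"
        unfolding abs_mult using u v b_le b1_le a(1)[of m]
        by (intro add_mono mult_mono) (auto simp: less_imp_le)
      also have "\<dots> < \<epsilon>"
        using a(2)[of m] \<epsilon>(1) by linarith
      finally show "\<bar>c t j - x j\<bar> < \<epsilon>" .
    next
      fix j assume j: "n \<le> j"
      then show "c t j = 0"
        using i x0[OF j] coord_box_zero[OF y(1) j] c_m[of j]
        by (simp add: u_def v_def)
    qed
  qed
  then have "smooth_curve W UNIV c"
    using \<epsilon>(2) c_smooth by (auto simp: smooth_curve_def)
  then have hc: "diff_times k UNIV (\<lambda>t. h (c t))" for k
    using h by (auto simp: curve_smooth_def)
  define D where "D = (deriv ^^ p) (\<lambda>t. h (c t))"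
  have D_eq: "D (\<tau> m) = a m ^ p * P (y m)" for m
  proof -
    define S where "S = {\<tau> m - \<rho> m<..<\<tau> m + \<rho> m}"
    define \<psi> where "\<psi> t = h ((y m)(i := t))" for t
    have S: "open S" "\<tau> m \<in> S"
      using \<rho>[of m] by (auto simp: S_def)
    have ym: "y m \<in> coord_box n x \<epsilon>"
      using y(1)[of m] coord_box_mono[of "a m" \<epsilon> n x] a(2)[of m] \<epsilon>(1) by auto
    have \<psi>: "diff_times p {x i - \<epsilon><..<x i + \<epsilon>} \<psi>"
      unfolding \<psi>_def by (rule curve_smooth_slice[OF h \<epsilon>(2) ym i])
    have "D (\<tau> m) = (deriv ^^ p) (\<lambda>t. \<psi> ((y m i - a m * \<tau> m) + a m * t)) (\<tau> m)"
      unfolding D_def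
    proof (rule iterated_deriv_cong_open[OF S])
      fix t assume "t \<in> S"
      then have "b m t = 1"
        by (intro b_eq_1) (auto simp: S_def)
      then have c_m: "c t j = x j + (u j m * b m t + v j m * b1 m t)" for j
        using single[of m t] by (intro c_eq) auto
      have "c t = (y m)(i := (y m i - a m * \<tau> m) + a m * t)"
      proof
        fix j
        show "c t j = ((y m)(i := (y m i - a m * \<tau> m) + a m * t)) j"
          unfolding c_m[of j] using \<open>b m t = 1\<close>
          by (auto simp: u_def v_def b1_def algebra_simps)
      qed
      then show "h (c t) = \<psi> ((y m i - a m * \<tau> m) + a m * t)"
        by (simp add: \<psi>_def)
    qed
    also have "\<dots> = a m ^ p * (deriv ^^ p) \<psi> ((y m i - a m * \<tau> m) + a m * \<tau> m)"
    proof (rule iterated_deriv_affine[OF S(1) \<psi> _ S(2)])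
      fix t assume "t \<in> S"
      then have "\<bar>t - \<tau> m\<bar> \<le> 1"
        using \<rho>[of m] by (auto simp: S_def)
      then have "a m * \<bar>t - \<tau> m\<bar> \<le> a m * 1"
        using a(1)[of m] by (intro mult_left_mono) auto
      then have "\<bar>a m * (t - \<tau> m)\<bar> \<le> a m * 1"
        using a(1)[of m] by (simp only: abs_mult abs_of_pos)
      then have "\<bar>a m * (t - \<tau> m)\<bar> \<le> \<epsilon> / 4"
        using a(2)[of m] by linarith
      moreover have "\<bar>y m i - x i\<bar> < \<epsilon> / 4"
        using coord_boxD[OF y(1)[of m] i] a(2)[of m] by linarith
      moreover have "(y m i - a m * \<tau> m) + a m * t = y m i + a m * (t - \<tau> m)"
        by (simp add: algebra_simps)
      ultimately show "(y m i - a m * \<tau> m) + a m * t \<in> {x i - \<epsilon><..<x i + \<epsilon>}"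
        unfolding greaterThanLessThan_iff using \<epsilon>(1) by linarith
    qed
    finally show ?thesis
      by (simp add: P_def \<psi>_def[abs_def])
  qed
  \<comment> \<open>These values contradict continuity of the \<open>p\<close>-th derivative of \<open>h \<circ> c\<close> at \<open>0 = lim \<tau> m\<close>.\<close>
  have D_large: "real m < \<bar>D (\<tau> m)\<bar>" for m
    using y(2)[of m] a(1)[of m] by (simp add: D_eq abs_mult field_simps)
  have "continuous_on UNIV D"
    unfolding D_def by (rule continuous_on_iterated_deriv[OF hc[of "Suc p"]]) simp
  then have "(\<lambda>m. D (\<tau> m)) \<longlonglongrightarrow> D 0"
    by (rule continuous_on_tendsto_compose) (auto simp: \<tau>_def intro!: LIMSEQ_power_zero)
  then have "Bseq (\<lambda>m. D (\<tau> m))"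
    by (auto intro!: convergent_imp_Bseq simp: convergent_def)
  then obtain K where "\<And>m. \<bar>D (\<tau> m)\<bar> \<le> K"
    by (auto simp: Bseq_def)
  moreover obtain m where "K < real m"
    using reals_Archimedean2 by blast
  ultimately show False
    using D_large[of m] by (meson less_le_trans not_less order_less_imp_le)
qed

section \<open>Partial derivatives inherit smoothness along curves\<close>

lemma difference_quotient_error:
  assumes h: "curve_smooth W h" and sub: "coord_box n x \<epsilon> \<subseteq> W" and i: "i < n"
    and K: "\<And>y. y \<in> coord_box n x \<epsilon> \<Longrightarrow> \<bar>(deriv ^^ 2) (\<lambda>t. h (y(i := t))) (y i)\<bar> \<le> K"
    and y: "y \<in> coord_box n x \<epsilon>" and \<tau>: "\<tau> \<noteq> 0" "\<bar>y i + \<tau> - x i\<bar> < \<epsilon>"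
  shows "\<bar>(h (y(i := y i + \<tau>)) - h y) / \<tau> - partial_deriv i h y\<bar> \<le> K * \<bar>\<tau>\<bar>"
proof -
  define \<psi> where "\<psi> t = h (y(i := t))" for t
  have \<psi>: "diff_times k {x i - \<epsilon><..<x i + \<epsilon>} \<psi>" for k
    unfolding \<psi>_def by (rule curve_smooth_slice[OF h sub y i])
  have yi: "y i \<in> {x i - \<epsilon><..<x i + \<epsilon>}" "y i + \<tau> \<in> {x i - \<epsilon><..<x i + \<epsilon>}"
    using coord_boxD[OF y i] \<tau> by (auto simp: abs_less_iff)
  have D1: "(\<psi> has_field_derivative deriv \<psi> z) (at z)"
    and D2: "(deriv \<psi> has_field_derivative (deriv ^^ 2) \<psi> z) (at z)"
    if "z \<in> {x i - \<epsilon><..<x i + \<epsilon>}" for z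
    using diff_times_has_iterated_deriv[OF \<psi>[of 2] that, of 0]
      diff_times_has_iterated_deriv[OF \<psi>[of 2] that, of 1] by (simp_all add: numeral_2_eq_2)
  have bound: "\<bar>(deriv ^^ 2) \<psi> z\<bar> \<le> K" if "z \<in> {x i - \<epsilon><..<x i + \<epsilon>}" for z
  proof -
    have "y(i := z) \<in> coord_box n x \<epsilon>"
      by (rule coord_box_upd[OF y i]) (use that in \<open>auto simp: abs_less_iff\<close>)
    then show ?thesis
      using K[of "y(i := z)"] by (simp add: \<psi>_def[abs_def])
  qed
  have seg: "z \<in> {x i - \<epsilon><..<x i + \<epsilon>}"
    if "a \<in> {x i - \<epsilon><..<x i + \<epsilon>}" "b \<in> {x i - \<epsilon><..<x i + \<epsilon>}" "min a b \<le> z" "z \<le> max a b" for a b z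
    using that by auto
  obtain z where z: "min (y i) (y i + \<tau>) \<le> z" "z \<le> max (y i) (y i + \<tau>)"
      "\<psi> (y i + \<tau>) - \<psi> (y i) = (y i + \<tau> - y i) * deriv \<psi> z"
    using mean_value_unordered[OF D1[OF seg[OF yi]]] by blast
  then have z_in: "z \<in> {x i - \<epsilon><..<x i + \<epsilon>}" and "\<bar>z - y i\<bar> \<le> \<bar>\<tau>\<bar>"
    using yi by auto
  obtain w where w: "min (y i) z \<le> w" "w \<le> max (y i) z"
      "deriv \<psi> z - deriv \<psi> (y i) = (z - y i) * (deriv ^^ 2) \<psi> w"
    using mean_value_unordered[OF D2[OF seg[OF yi(1) z_in]]] by blast
  have "w \<in> {x i - \<epsilon><..<x i + \<epsilon>}"
    using w(1,2) yi z_in by auto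
  have "(h (y(i := y i + \<tau>)) - h y) / \<tau> = deriv \<psi> z"
    using z(3) \<tau>(1) by (simp add: \<psi>_def)
  then have "\<bar>(h (y(i := y i + \<tau>)) - h y) / \<tau> - partial_deriv i h y\<bar> = \<bar>z - y i\<bar> * \<bar>(deriv ^^ 2) \<psi> w\<bar>"
    using w(3) by (simp add: partial_deriv_def \<psi>_def[abs_def] abs_mult)
  also have "\<dots> \<le> \<bar>\<tau>\<bar> * K"
    using bound[OF \<open>w \<in> _\<close>] \<open>\<bar>z - y i\<bar> \<le> \<bar>\<tau>\<bar>\<close> by (intro mult_mono) auto
  finally show ?thesis
    by (simp add: mult.commute)
qed

text \<open>With a local bound on the second slice derivative, \<open>\<partial>\<^sub>ih\<close> is a locally uniform limit of
  difference quotients of \<open>h\<close>, which are continuous.\<close>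

lemma partial_deriv_continuous:
  assumes W: "openin (Euclidean_space n) W" and h: "curve_smooth W h" and i: "i < n"
    and cont: "continuous_map (subtopology (Euclidean_space n) W) euclideanreal h"
  shows "continuous_map (subtopology (Euclidean_space n) W) euclideanreal (partial_deriv i h)"
  unfolding continuous_map_coord_box_iff[OF W]
proof (intro ballI allI impI)
  fix x and e :: real assume x: "x \<in> W" and e: "e > 0"
  have xE: "x \<in> topspace (Euclidean_space n)"
    using x openin_subset[OF W] by auto
  obtain \<epsilon> K where \<epsilon>: "\<epsilon> > 0" "coord_box n x \<epsilon> \<subseteq> W"
      and K: "\<And>y. y \<in> coord_box n x \<epsilon> \<Longrightarrow> \<bar>(deriv ^^ 2) (\<lambda>t. h (y(i := t))) (y i)\<bar> \<le> K"
    using locally_bounded_slice_derivative[OF W h x i, of 2] by blast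
  have "K \<ge> 0"
    using K[OF coord_box_center[OF xE \<epsilon>(1)]] by linarith
  define \<tau> where "\<tau> = min (\<epsilon> / 2) (e / (4 * (K + 1)))"
  have \<tau>: "0 < \<tau>" "\<tau> \<le> \<epsilon> / 2" "K * \<tau> \<le> e / 4"
  proof -
    show "0 < \<tau>"
      using \<epsilon> e \<open>K \<ge> 0\<close> by (auto simp: \<tau>_def)
    show "\<tau> \<le> \<epsilon> / 2"
      unfolding \<tau>_def by (rule min.cobounded1)
    have "K * \<tau> \<le> K * (e / (4 * (K + 1)))"
      using \<open>K \<ge> 0\<close> by (intro mult_left_mono) (auto simp: \<tau>_def)
    also have "\<dots> = (K / (K + 1)) * (e / 4)"
      using \<open>K \<ge> 0\<close> by (simp add: field_simps)
    also have "\<dots> \<le> 1 * (e / 4)"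
      using \<open>K \<ge> 0\<close> e by (intro mult_right_mono) auto
    finally show "K * \<tau> \<le> e / 4" by simp
  qed
  define x' where "x' = x(i := x i + \<tau>)"
  have x'W: "x' \<in> W"
    unfolding x'_def using \<epsilon> \<tau> by (intro subsetD[OF \<epsilon>(2)] coord_box_upd coord_box_center xE i) auto
  note cont_iff = cont[unfolded continuous_map_coord_box_iff[OF W], rule_format]
  have e': "e / 4 * \<tau> > 0"
    using e \<tau> by simp
  obtain \<delta>1 where \<delta>1: "\<delta>1 > 0" "\<And>y. y \<in> coord_box n x \<delta>1 \<inter> W \<Longrightarrow> \<bar>h y - h x\<bar> < e / 4 * \<tau>"
    using cont_iff[OF x e'] by blast
  obtain \<delta>2 where \<delta>2: "\<delta>2 > 0" "\<And>y. y \<in> coord_box n x' \<delta>2 \<inter> W \<Longrightarrow> \<bar>h y - h x'\<bar> < e / 4 * \<tau>"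
    using cont_iff[OF x'W e'] by blast
  define \<delta> where "\<delta> = min (\<epsilon> / 2) (min \<delta>1 \<delta>2)"
  show "\<exists>\<delta>>0. \<forall>y\<in>coord_box n x \<delta> \<inter> W. \<bar>partial_deriv i h y - partial_deriv i h x\<bar> < e"
  proof (intro exI[of _ \<delta>] conjI ballI)
    show "\<delta> > 0"
      using \<delta>1 \<delta>2 \<epsilon> by (simp add: \<delta>_def)
    fix y assume y: "y \<in> coord_box n x \<delta> \<inter> W"
    have "\<delta> \<le> \<epsilon>" "\<delta> \<le> \<delta>1" "\<delta> \<le> \<delta>2" "\<delta> \<le> \<epsilon> / 2"
      using \<epsilon>(1) by (auto simp: \<delta>_def)
    then have y\<epsilon>: "y \<in> coord_box n x \<epsilon>" and y1: "y \<in> coord_box n x \<delta>1"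
      using y coord_box_mono[of \<delta> \<epsilon> n x] coord_box_mono[of \<delta> \<delta>1 n x] by auto
    define y' where "y' = y(i := y i + \<tau>)"
    have yi: "\<bar>y i + \<tau> - x i\<bar> < \<epsilon>"
      using coord_boxD[of y n x \<delta> i] y i \<tau> \<open>\<delta> \<le> \<epsilon> / 2\<close> by auto
    have "y' \<in> W"
      unfolding y'_def using \<epsilon>(2) coord_box_upd[OF y\<epsilon> i yi] by auto
    moreover have "y' \<in> coord_box n x' \<delta>2"
      using y i \<open>\<delta> \<le> \<delta>2\<close> by (force simp: coord_box_def y'_def x'_def topspace_Euclidean_space)
    ultimately have "\<bar>h y' - h x'\<bar> < e / 4 * \<tau>"
      using \<delta>2(2) by blast
    moreover have "\<bar>h y - h x\<bar> < e / 4 * \<tau>"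
      using \<delta>1(2) y y1 by blast
    ultimately have "\<bar>(h y' - h y) - (h x' - h x)\<bar> < e / 2 * \<tau>"
      by linarith
    then have "\<bar>(h y' - h y) - (h x' - h x)\<bar> / \<tau> < e / 2"
      using \<tau>(1) by (simp add: field_simps)
    then have "\<bar>(h y' - h y) / \<tau> - (h x' - h x) / \<tau>\<bar> < e / 2"
      using \<tau>(1) by (simp add: abs_divide flip: diff_divide_distrib)
    moreover have "\<bar>(h y' - h y) / \<tau> - partial_deriv i h y\<bar> \<le> K * \<bar>\<tau>\<bar>"
      unfolding y'_def using \<tau> by (intro difference_quotient_error[OF h \<epsilon>(2) i K y\<epsilon> _ yi]) auto
    moreover have "\<bar>(h x' - h x) / \<tau> - partial_deriv i h x\<bar> \<le> K * \<bar>\<tau>\<bar>"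
      unfolding x'_def using \<tau> \<epsilon>(1)
      by (intro difference_quotient_error[OF h \<epsilon>(2) i K coord_box_center[OF xE \<epsilon>(1)]]) auto
    moreover have "K * \<bar>\<tau>\<bar> \<le> e / 4"
      using \<tau> by simp
    ultimately show "\<bar>partial_deriv i h y - partial_deriv i h x\<bar> < e"
      by linarith
  qed
qed

text \<open>The interval around \<open>s0\<close> may shrink as \<open>p\<close> grows, because the bounds on the derivatives of
  \<open>F\<close> hold on neighbourhoods depending on their order. The difference quotients are taken at the
  steps \<open>H m = r m ^ (2 * p)\<close> with \<open>r m\<close> proportional to \<open>2\<^sup>-\<^sup>m\<close>, and \<open>r m\<close> itself is the
  interpolation scale. The successive differences \<open>w m\<close> are \<open>O(H m)\<close>, with derivatives of order
  \<open>N = 4 * p\<close> that are \<open>O(1 / H m)\<close>; both contributions to the interpolated bound for order \<open>k\<close>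
  then equal \<open>r m ^ (2 * p - k)\<close> up to constants, hence are at most \<open>r m\<close> when \<open>1 \<le> p\<close> and
  \<open>k \<le> p\<close>.\<close>

lemma partial_deriv_curve_diff_times:
  assumes W: "openin (Euclidean_space n) W" and h: "curve_smooth W h" and i: "i < n"
    and c: "smooth_curve W UNIV c" and p: "1 \<le> p"
  shows "\<exists>\<eta>>0. diff_times p {s0 - \<eta><..<s0 + \<eta>} (\<lambda>s. partial_deriv i h (c s))"
proof -
  define x where "x = c s0"
  have x: "x \<in> W"
    using c by (auto simp: smooth_curve_def x_def)
  have cE: "c s \<in> topspace (Euclidean_space n)" for s
    using c openin_subset[OF W] by (auto simp: smooth_curve_def)
  have c_smooth: "diff_times k UNIV (\<lambda>t. c t j)" for j k
    using c by (auto simp: smooth_curve_def)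
  obtain \<epsilon> K2 where \<epsilon>: "\<epsilon> > 0" "coord_box n x \<epsilon> \<subseteq> W"
      and K2: "\<And>y. y \<in> coord_box n x \<epsilon> \<Longrightarrow> \<bar>(deriv ^^ 2) (\<lambda>t. h (y(i := t))) (y i)\<bar> \<le> K2"
    using locally_bounded_slice_derivative[OF W h x i, of 2] by blast
  have "K2 \<ge> 0"
    using K2[OF coord_box_center[OF _ \<epsilon>(1)]] cE[of s0] by (fastforce simp: x_def)
  have "\<forall>\<^sub>F s in nhds s0. c s \<in> coord_box n (c s0) (\<epsilon> / 2)"
    using \<epsilon>(1) by (intro eventually_coord_box smooth_curve_continuous[OF c] cE) auto
  then obtain \<delta>0 where \<delta>0: "\<delta>0 > 0" "\<And>s j. \<bar>s - s0\<bar> < \<delta>0 \<Longrightarrow> j < n \<Longrightarrow> \<bar>c s j - c s0 j\<bar> < \<epsilon> / 2"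
    unfolding eventually_nhds_metric dist_real_def coord_box_def by auto
  define \<delta> where "\<delta> = min \<delta>0 (\<epsilon> / 2)"
  have \<delta>: "\<delta> > 0" "\<delta> \<le> \<epsilon> / 2" "\<And>s j. \<bar>s - s0\<bar> < \<delta> \<Longrightarrow> j < n \<Longrightarrow> \<bar>c s j - x j\<bar> < \<epsilon> / 2"
    using \<delta>0 \<epsilon> by (auto simp: \<delta>_def x_def)
  have c_box: "c s \<in> coord_box n x \<epsilon>" if "\<bar>s - s0\<bar> < \<delta>" for s
    using \<delta>(3)[OF that] \<epsilon>(1) cE[of s] unfolding coord_box_def by fastforce
  have c_box': "\<bar>c s i + t - x i\<bar> < \<epsilon>" if "\<bar>s - s0\<bar> < \<delta>" "\<bar>t\<bar> < \<delta>" for s t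
    using \<delta>(3)[OF that(1) i] that(2) \<delta>(2) by linarith

  \<comment> \<open>The plane is modelled as \<^term>\<open>Euclidean_space 2\<close>, so that the local bounds apply to \<open>F\<close>.\<close>
  define pt :: "real \<Rightarrow> real \<Rightarrow> nat \<Rightarrow> real" where "pt s t = (\<lambda>j. if j = 0 then s else if j = 1 then t else 0)" for s t
  define F where "F y = h ((c (y 0))(i := c (y 0) i + y 1))" for y :: "nat \<Rightarrow> real"
  define V where "V = coord_box 2 (pt s0 0) \<delta>"
  have pt_box: "pt s t \<in> coord_box 2 (pt s0 0) \<epsilon>' \<longleftrightarrow> \<bar>s - s0\<bar> < \<epsilon>' \<and> \<bar>t\<bar> < \<epsilon>'" for s t \<epsilon>'
    by (auto simp: coord_box_def pt_def topspace_Euclidean_space less_2_cases_iff)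
  have F: "curve_smooth V F"
    unfolding curve_smooth_def F_def
  proof (intro allI impI)
    fix \<gamma> k assume \<gamma>: "smooth_curve V UNIV \<gamma>"
    have \<gamma>_smooth: "diff_times k UNIV (\<lambda>t. \<gamma> t j)" for j k
      using \<gamma> by (auto simp: smooth_curve_def)
    have c\<gamma>: "diff_times k UNIV (\<lambda>t. c (\<gamma> t 0) j)" for j k
      by (rule diff_times_compose[OF open_UNIV c_smooth \<gamma>_smooth]) auto
    have "smooth_curve W UNIV (\<lambda>t. (c (\<gamma> t 0))(i := c (\<gamma> t 0) i + \<gamma> t 1))"
      unfolding smooth_curve_def
    proof (intro conjI allI)
      show "(\<lambda>t. (c (\<gamma> t 0))(i := c (\<gamma> t 0) i + \<gamma> t 1)) ` UNIV \<subseteq> W"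
      proof clarify
        fix t
        have "\<gamma> t \<in> V"
          using \<gamma> by (auto simp: smooth_curve_def)
        then have "\<bar>\<gamma> t 0 - s0\<bar> < \<delta>" "\<bar>\<gamma> t 1\<bar> < \<delta>"
          using coord_boxD[of "\<gamma> t" 2 "pt s0 0" \<delta> 0] coord_boxD[of "\<gamma> t" 2 "pt s0 0" \<delta> 1]
          by (auto simp: V_def pt_def)
        then show "(c (\<gamma> t 0))(i := c (\<gamma> t 0) i + \<gamma> t 1) \<in> W"
          using c_box c_box' by (intro subsetD[OF \<epsilon>(2)] coord_box_upd i) auto
      qed
      show "diff_times k UNIV (\<lambda>t. ((c (\<gamma> t 0))(i := c (\<gamma> t 0) i + \<gamma> t 1)) j)" for j k
        by (cases "j = i") (auto intro: diff_times_add c\<gamma> \<gamma>_smooth)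
    qed
    then show "diff_times k UNIV (\<lambda>t. h ((c (\<gamma> t 0))(i := c (\<gamma> t 0) i + \<gamma> t 1)))"
      using h by (auto simp: curve_smooth_def)
  qed
  define N where "N = 4 * p"
  have "pt s0 0 \<in> V"
    using \<delta>(1) by (simp add: V_def pt_box)
  then obtain \<epsilon>1 K1 where \<epsilon>1: "\<epsilon>1 > 0" "coord_box 2 (pt s0 0) \<epsilon>1 \<subseteq> V"
      and K1: "\<And>y. y \<in> coord_box 2 (pt s0 0) \<epsilon>1 \<Longrightarrow> \<bar>(deriv ^^ N) (\<lambda>s. F (y(0 := s))) (y 0)\<bar> \<le> K1"
    using locally_bounded_slice_derivative[OF openin_coord_box F[unfolded V_def], of "pt s0 0" 0 N]
    unfolding V_def by auto
  define G where "G t s = h ((c s)(i := c s i + t))" for t s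
  have G_F: "G t s = F (pt s t)" for s t
    by (simp add: G_def F_def pt_def)
  have slice: "(\<lambda>s'. F ((pt s t)(0 := s'))) = G t" for s t
  proof
    fix s'
    have "(pt s t)(0 := s') = pt s' t"
      by (auto simp: pt_def)
    then show "F ((pt s t)(0 := s')) = G t s'"
      by (simp add: G_F)
  qed
  define \<eta> where "\<eta> = min \<epsilon>1 \<delta> / 2"
  have \<eta>: "\<eta> > 0" "2 * \<eta> \<le> \<epsilon>1" "2 * \<eta> \<le> \<delta>"
    using \<epsilon>1 \<delta> by (auto simp: \<eta>_def)
  define S where "S = {s0 - 2 * \<eta><..<s0 + 2 * \<eta>}"
  have S: "open S" "{s0 - \<eta>..s0 + \<eta>} \<subseteq> S"
    using \<eta>(1) by (auto simp: S_def)
  have G_smooth: "diff_times k S (G t)" if "\<bar>t\<bar> < 2 * \<eta>" for k t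
  proof -
    have "diff_times k {pt s0 0 0 - 2 * \<eta><..<pt s0 0 0 + 2 * \<eta>} (\<lambda>s'. F ((pt s0 t)(0 := s')))"
    proof (rule curve_smooth_slice[OF F])
      show "coord_box 2 (pt s0 0) (2 * \<eta>) \<subseteq> V"
        unfolding V_def by (rule coord_box_mono[OF \<eta>(3)])
      show "pt s0 t \<in> coord_box 2 (pt s0 0) (2 * \<eta>)"
        using that \<eta>(1) by (simp add: pt_box)
    qed simp
    then show ?thesis
      unfolding slice by (simp add: S_def pt_def)
  qed
  have G_bound: "\<bar>(deriv ^^ N) (G t) s\<bar> \<le> K1" if "\<bar>t\<bar> < 2 * \<eta>" "s \<in> S" for s t
  proof -
    have "pt s t \<in> coord_box 2 (pt s0 0) \<epsilon>1"
      using that \<eta>(2) by (auto simp: pt_box S_def abs_less_iff)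
    from K1[OF this] show ?thesis
      unfolding slice by (simp add: pt_def)
  qed
  have "K1 \<ge> 0"
    using G_bound[of 0 s0] \<eta>(1) by (simp add: S_def)
  define v where "v s = partial_deriv i h (c s)" for s
  define q where "q t s = 1 / t * G t s + (- 1 / t) * G 0 s" for t s
  have q_smooth: "diff_times k S (q t)" if "\<bar>t\<bar> < 2 * \<eta>" for k t
    unfolding q_def using that \<eta>(1) by (intro diff_times_add diff_times_cmult G_smooth S) auto
  have q_error: "\<bar>q t s - v s\<bar> \<le> K2 * t" if "0 < t" "t < 2 * \<eta>" "s \<in> S" for s t
  proof -
    have s: "\<bar>s - s0\<bar> < \<delta>" "\<bar>t\<bar> < \<delta>"
      using that \<eta>(3) by (auto simp: S_def abs_less_iff)
    have "\<bar>(h ((c s)(i := c s i + t)) - h (c s)) / t - partial_deriv i h (c s)\<bar> \<le> K2 * \<bar>t\<bar>"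
      using that(1) by (intro difference_quotient_error[OF h \<epsilon>(2) i K2 c_box[OF s(1)] _ c_box'[OF s]]) auto
    then show ?thesis
      using that(1) by (simp add: q_def v_def G_def diff_divide_distrib)
  qed
  have q_bound: "\<bar>(deriv ^^ N) (q t) s\<bar> \<le> 2 * K1 / t" if "0 < t" "t < 2 * \<eta>" "s \<in> S" for s t
  proof -
    have "(deriv ^^ N) (q t) s = 1 / t * (deriv ^^ N) (G t) s + (- 1 / t) * (deriv ^^ N) (G 0) s"
      unfolding q_def using that \<eta>(1) by (intro iterated_deriv_lincomb[OF S(1)] G_smooth) auto
    also have "\<bar>\<dots>\<bar> \<le> \<bar>1 / t * (deriv ^^ N) (G t) s\<bar> + \<bar>(- 1 / t) * (deriv ^^ N) (G 0) s\<bar>"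
      by (rule abs_triangle_ineq)
    also have "\<dots> \<le> 1 / t * K1 + 1 / t * K1"
      unfolding abs_mult using that \<eta>(1) by (intro add_mono mult_mono G_bound) auto
    finally show ?thesis by simp
  qed

  define \<rho> where "\<rho> = min 1 \<eta>"
  define r where "r m = \<rho> * (1/2) ^ m" for m
  define H where "H m = r m ^ (2 * p)" for m
  have \<rho>: "0 < \<rho>" "\<rho> \<le> 1" "\<rho> \<le> \<eta>"
    using \<eta>(1) by (auto simp: \<rho>_def)
  have r: "0 < r m" "r m \<le> \<rho>" "r m \<le> 1" for m
  proof -
    show "0 < r m"
      using \<rho> by (simp add: r_def)
    have "\<rho> * (1/2) ^ m \<le> \<rho> * 1"
      using \<rho> by (intro mult_left_mono) (auto simp: power_le_one)
    then show "r m \<le> \<rho>"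
      by (simp add: r_def)
    then show "r m \<le> 1"
      using \<rho> by simp
  qed
  have H: "0 < H m" "H m \<le> r m" "H m < 2 * \<eta>" "H (Suc m) \<le> H m" for m
  proof -
    show "0 < H m"
      using r by (simp add: H_def)
    have "r m ^ (2 * p) \<le> r m ^ 1"
      using r[of m] p by (intro power_decreasing) auto
    then show "H m \<le> r m"
      by (simp add: H_def)
    then show "H m < 2 * \<eta>"
      using r[of m] \<rho> \<eta>(1) by linarith
    show "H (Suc m) \<le> H m"
      unfolding H_def using r[of "Suc m"] \<rho>(1) by (intro power_mono) (auto simp: r_def)
  qed
  have H_Suc: "H m = 2 ^ (2 * p) * H (Suc m)" for m
    by (simp add: H_def r_def power_mult_distrib power_divide)
  define w where "w m s = 1 * q (H (Suc m)) s + (- 1) * q (H m) s" for m s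
  have H_abs: "\<bar>H m\<bar> < 2 * \<eta>" for m
    using H[of m] by simp
  have w_smooth: "diff_times k S (w m)" for k m
    unfolding w_def by (intro diff_times_add diff_times_cmult q_smooth H_abs S)
  define B where "B = 2 * K2 + 4 * K1 * 2 ^ (2 * p)"
  have "\<exists>C. \<forall>m. \<forall>s\<in>{s0 - \<eta><..<s0 + \<eta>}. \<bar>(deriv ^^ k) (w m) s\<bar> \<le> C * (1/2) ^ m" if "k \<le> p" for k
  proof -
    have "k \<le> N" "s0 - \<eta> < s0 + \<eta>"
      using that \<eta>(1) by (auto simp: N_def)
    from derivative_interpolation[OF this] obtain C :: real where C: "C \<ge> 0"
      "\<forall>g S A B r. (\<forall>j. diff_times j S g) \<longrightarrow> {s0 - \<eta>..s0 + \<eta>} \<subseteq> S \<longrightarrow>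
        (\<forall>x\<in>{s0 - \<eta>..s0 + \<eta>}. \<bar>g x\<bar> \<le> A) \<longrightarrow>
        (\<forall>x\<in>{s0 - \<eta>..s0 + \<eta>}. \<bar>(deriv ^^ N) g x\<bar> \<le> B) \<longrightarrow>
        0 < r \<longrightarrow> 2 * r \<le> (s0 + \<eta>) - (s0 - \<eta>) \<longrightarrow>
        (\<forall>x\<in>{s0 - \<eta>..s0 + \<eta>}. r ^ k * \<bar>(deriv ^^ k) g x\<bar> \<le> C * (A + r ^ N * B))"
      by blast
    note interpolate = C(2)[rule_format]
    have "\<bar>(deriv ^^ k) (w m) s\<bar> \<le> C * B * \<rho> * (1/2) ^ m" if s: "s \<in> {s0 - \<eta>..s0 + \<eta>}" for m s
    proof -
      have A: "\<bar>w m s\<bar> \<le> 2 * K2 * H m" if "s \<in> {s0 - \<eta>..s0 + \<eta>}" for s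
      proof -
        have "s \<in> S"
          using that S by auto
        then have "\<bar>w m s\<bar> \<le> K2 * H (Suc m) + K2 * H m"
          using q_error[of "H (Suc m)" s] q_error[of "H m" s] H[of m] H[of "Suc m"]
          by (simp add: w_def)
        also have "\<dots> \<le> K2 * H m + K2 * H m"
          using H[of m] \<open>K2 \<ge> 0\<close> by (intro add_mono mult_left_mono) auto
        finally show ?thesis by simp
      qed
      have D: "\<bar>(deriv ^^ N) (w m) s\<bar> \<le> 4 * K1 * 2 ^ (2 * p) / H m" if "s \<in> {s0 - \<eta>..s0 + \<eta>}" for s
      proof -
        have "s \<in> S"
          using that S by auto
        then have "(deriv ^^ N) (w m) s = 1 * (deriv ^^ N) (q (H (Suc m))) s + (- 1) * (deriv ^^ N) (q (H m)) s"
          unfolding w_def by (intro iterated_deriv_lincomb[OF S(1)] q_smooth H_abs)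
        then have "\<bar>(deriv ^^ N) (w m) s\<bar> \<le> 2 * K1 / H (Suc m) + 2 * K1 / H m"
          using q_bound[of "H (Suc m)" s] q_bound[of "H m" s] H[of m] H[of "Suc m"] \<open>s \<in> S\<close>
          by simp
        also have "\<dots> \<le> 2 * K1 / H (Suc m) + 2 * K1 / H (Suc m)"
          using H[of m] H[of "Suc m"] \<open>K1 \<ge> 0\<close> by (intro add_mono divide_left_mono) auto
        also have "\<dots> = 4 * K1 * 2 ^ (2 * p) / H m"
          using H[of "Suc m"] by (simp add: H_Suc[of m])
        finally show ?thesis .
      qed
      have "r m ^ N * (4 * K1 * 2 ^ (2 * p) / H m) = 4 * K1 * 2 ^ (2 * p) * H m"
        using r[of m] by (simp add: N_def H_def field_simps flip: power_add)
      then have eq: "2 * K2 * H m + r m ^ N * (4 * K1 * 2 ^ (2 * p) / H m) = B * H m"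
        by (simp add: B_def algebra_simps)
      have "B \<ge> 0"
        using \<open>K1 \<ge> 0\<close> \<open>K2 \<ge> 0\<close> by (simp add: B_def)
      have "r m ^ k * \<bar>(deriv ^^ k) (w m) s\<bar> \<le> C * (2 * K2 * H m + r m ^ N * (4 * K1 * 2 ^ (2 * p) / H m))"
        using interpolate[OF w_smooth S(2) A D r(1) _ s] r[of m] \<rho> by simp
      also have "\<dots> = C * B * r m ^ (2 * p)"
        unfolding eq by (simp add: H_def)
      also have "\<dots> \<le> C * B * r m ^ (k + 1)"
        using r[of m] \<open>k \<le> p\<close> p C(1) \<open>B \<ge> 0\<close> by (intro mult_left_mono power_decreasing) auto
      also have "\<dots> = r m ^ k * (C * B * r m)"
        by simp
      finally have "\<bar>(deriv ^^ k) (w m) s\<bar> \<le> C * B * r m"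
        using r[of m] by simp
      then show ?thesis
        by (simp add: r_def)
    qed
    then show ?thesis
      by (intro exI[of _ "C * B * \<rho>"]) auto
  qed
  then have "diff_times p {s0 - \<eta><..<s0 + \<eta>} (\<lambda>s. \<Sum>m. w m s)"
    by (intro diff_times_suminf diff_times_mono[OF w_smooth order_refl]) (use S in auto)
  moreover have "diff_times p {s0 - \<eta><..<s0 + \<eta>} (q (H 0))"
    by (rule diff_times_mono[OF q_smooth[OF H_abs] order_refl]) (use S in auto)
  ultimately have "diff_times p {s0 - \<eta><..<s0 + \<eta>} (\<lambda>s. (\<Sum>m. w m s) + q (H 0) s)"
    by (intro diff_times_add) auto
  moreover have "(\<Sum>m. w m s) + q (H 0) s = v s" if "s \<in> {s0 - \<eta><..<s0 + \<eta>}" for s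
  proof -
    have "s \<in> S"
      using that S by auto
    have "r \<longlonglongrightarrow> \<rho> * 0"
      unfolding r_def by (intro tendsto_mult tendsto_const LIMSEQ_power_zero) auto
    then have "r \<longlonglongrightarrow> 0"
      by simp
    then have "H \<longlonglongrightarrow> 0"
      by (rule real_tendsto_sandwich[OF _ _ tendsto_const, rotated 2])
        (auto intro!: always_eventually H less_imp_le[OF H(1)])
    then have "(\<lambda>m. K2 * H m) \<longlonglongrightarrow> K2 * 0"
      by (intro tendsto_intros)
    then have "(\<lambda>m. K2 * H m) \<longlonglongrightarrow> 0"
      by simp
    moreover have "\<forall>\<^sub>F m in sequentially. norm (q (H m) s - v s) \<le> K2 * H m"
      by (intro always_eventually allI) (simp add: q_error H \<open>s \<in> S\<close>)
    ultimately have "(\<lambda>m. q (H m) s - v s) \<longlonglongrightarrow> 0"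
      by (rule Lim_null_comparison[rotated])
    then have "(\<lambda>m. q (H m) s) \<longlonglongrightarrow> v s"
      by (simp add: LIM_zero_iff)
    from telescope_sums[OF this] have "(\<lambda>m. w m s) sums (v s - q (H 0) s)"
      by (simp add: w_def)
    then show ?thesis
      by (simp add: sums_iff)
  qed
  ultimately have "diff_times p {s0 - \<eta><..<s0 + \<eta>} v"
    by (rule diff_times_cong[rotated]) auto
  then show ?thesis
    unfolding v_def[abs_def] using \<eta>(1) by blast
qed

lemma partial_deriv_curve_smooth:
  assumes W: "openin (Euclidean_space n) W" and h: "curve_smooth W h" and i: "i < n"
  shows "curve_smooth W (partial_deriv i h)"
  unfolding curve_smooth_def
proof (intro allI impI)
  fix c k assume c: "smooth_curve W UNIV c"
  show "diff_times k UNIV (\<lambda>t. partial_deriv i h (c t))"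
  proof (rule diff_times_local)
    fix s
    obtain \<eta> where \<eta>: "\<eta> > 0" "diff_times (Suc k) {s - \<eta><..<s + \<eta>} (\<lambda>t. partial_deriv i h (c t))"
      using partial_deriv_curve_diff_times[OF W h i c, of "Suc k" s] by auto
    from \<eta>(2) have "diff_times k {s - \<eta><..<s + \<eta>} (\<lambda>t. partial_deriv i h (c t))"
      by (rule diff_times_mono) auto
    then show "\<exists>U. s \<in> U \<and> diff_times k U (\<lambda>t. partial_deriv i h (c t))"
      using \<eta>(1) by (intro exI[of _ "{s - \<eta><..<s + \<eta>}"]) auto
  qed
qed

text \<open>Boman's theorem. Both hypotheses pass from \<open>h\<close> to its partial derivatives, which is all the
  recursive definition of \<^term>\<open>C_k\<close> asks for.\<close>

theorem curve_smooth_imp_C_infinity: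
  assumes W: "openin (Euclidean_space n) W"
    and "continuous_map (subtopology (Euclidean_space n) W) euclideanreal h" "curve_smooth W h"
  shows "C_infinity n W h"
proof -
  have "C_k n k W h" for k
    using assms(2,3)
  proof (induction k arbitrary: h)
    case (Suc k)
    have "(\<lambda>t. h (x(i := t))) field_differentiable at (x i)" if i: "i < n" and xW: "x \<in> W" for i x
    proof -
      obtain \<epsilon> where \<epsilon>: "\<epsilon> > 0" "coord_box n x \<epsilon> \<subseteq> W"
        using openin_contains_coord_box[OF W xW] .
      have x: "x \<in> coord_box n x \<epsilon>"
        using openin_subset[OF W] xW \<epsilon>(1) by (intro coord_box_center) auto
      have "diff_times 1 {x i - \<epsilon><..<x i + \<epsilon>} (\<lambda>t. h (x(i := t)))"
        by (rule curve_smooth_slice[OF Suc.prems(2) \<epsilon>(2) x i])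
      then show ?thesis
        using \<epsilon>(1) by simp
    qed
    then show ?case
      using Suc partial_deriv_continuous[OF W Suc.prems(2) _ Suc.prems(1)]
        partial_deriv_curve_smooth[OF W Suc.prems(2)] by simp
  qed simp
  then show ?thesis
    by (simp add: C_infinity_def)
qed

section \<open>The chain rule along curves\<close>

text \<open>The increment of \<open>h\<close> when the \<open>k\<close>-th coordinate moves from \<open>c t\<close> to \<open>c s\<close>, the earlier ones
  having moved already. By the mean value theorem it is \<open>c s k - c t k\<close> times a value of the partial
  derivative at a point that tends to \<open>c t\<close>, so only continuity of that partial derivative enters.\<close>

lemma DERIV_telescoping_term:
  assumes W: "openin (Euclidean_space n) W" and k: "k < n"
    and diff: "\<And>y. y \<in> W \<Longrightarrow> (\<lambda>s. h (y(k := s))) field_differentiable at (y k)"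
    and cont: "continuous_map (subtopology (Euclidean_space n) W) euclideanreal (partial_deriv k h)"
    and c: "\<And>j. continuous_on UNIV (\<lambda>s. c s j)" "\<And>s. c s \<in> W"
    and c': "((\<lambda>s. c s k) has_field_derivative c') (at t)"
  shows "((\<lambda>s. h (\<lambda>j. if j < Suc k then c s j else c t j) - h (\<lambda>j. if j < k then c s j else c t j))
    has_field_derivative c' * partial_deriv k h (c t)) (at t)"
proof -
  define x where "x = c t"
  define y where "y s = (\<lambda>j. if j < k then c s j else c t j)" for s
  have cE: "c s \<in> topspace (Euclidean_space n)" for s
    using c(2) openin_subset[OF W] by auto
  have x: "x \<in> W"
    using c(2) by (simp add: x_def)
  obtain \<epsilon> where \<epsilon>: "\<epsilon> > 0" "coord_box n x \<epsilon> \<subseteq> W"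
    using openin_contains_coord_box[OF W x] .
  have y_box: "(y s)(k := z) \<in> coord_box n x \<delta>"
    if "c s \<in> coord_box n x \<delta>" "min (c t k) (c s k) \<le> z" "z \<le> max (c t k) (c s k)" for s z \<delta>
  proof (rule coord_boxI)
    have "\<delta> > 0"
      using coord_boxD[OF that(1) k] by linarith
    show "\<bar>((y s)(k := z)) j - x j\<bar> < \<delta>" if "j < n" for j
      using coord_boxD[OF \<open>c s \<in> coord_box n x \<delta>\<close> that] \<open>min (c t k) (c s k) \<le> z\<close> \<open>z \<le> max (c t k) (c s k)\<close>
        \<open>\<delta> > 0\<close> by (auto simp: y_def x_def)
    show "((y s)(k := z)) j = 0" if "n \<le> j" for j
      using cE[of s] cE[of t] that k by (auto simp: y_def topspace_Euclidean_space)
  qed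
  have y_Suc: "(\<lambda>j. if j < Suc k then c s j else c t j) = (y s)(k := c s k)" for s
    by (auto simp: y_def)
  have y_k: "y s = (y s)(k := c t k)" for s
    by (auto simp: y_def)
  have "\<exists>z. c s \<in> coord_box n x \<epsilon> \<longrightarrow> min (c t k) (c s k) \<le> z \<and> z \<le> max (c t k) (c s k) \<and>
      h ((y s)(k := c s k)) - h (y s) = (c s k - c t k) * partial_deriv k h ((y s)(k := z))" for s
  proof (cases "c s \<in> coord_box n x \<epsilon>")
    case True
    have "\<exists>z. min (c t k) (c s k) \<le> z \<and> z \<le> max (c t k) (c s k) \<and>
        h ((y s)(k := c s k)) - h ((y s)(k := c t k)) = (c s k - c t k) * partial_deriv k h ((y s)(k := z))"
    proof (rule mean_value_unordered[where f = "\<lambda>z. h ((y s)(k := z))"])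
      fix z assume "min (c t k) (c s k) \<le> z" "z \<le> max (c t k) (c s k)"
      then have "(y s)(k := z) \<in> W"
        using y_box[OF True] \<epsilon>(2) by blast
      then show "((\<lambda>z. h ((y s)(k := z))) has_field_derivative partial_deriv k h ((y s)(k := z))) (at z)"
        using diff[of "(y s)(k := z)"] by (simp add: partial_deriv_def field_differentiable_derivI)
    qed
    then show ?thesis
      using y_k[of s] by auto
  qed auto
  then obtain \<zeta> where \<zeta>: "\<And>s. c s \<in> coord_box n x \<epsilon> \<Longrightarrow>
      min (c t k) (c s k) \<le> \<zeta> s \<and> \<zeta> s \<le> max (c t k) (c s k) \<and>
      h ((y s)(k := c s k)) - h (y s) = (c s k - c t k) * partial_deriv k h ((y s)(k := \<zeta> s))"
    by metis
  have near: "\<forall>\<^sub>F s in at t. c s \<in> coord_box n x \<delta>" if "\<delta> > 0" for \<delta>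
    using eventually_coord_box[OF c(1) cE that, of t] unfolding x_def eventually_at_filter
    by (rule eventually_mono) auto
  have lim: "((\<lambda>s. partial_deriv k h ((y s)(k := \<zeta> s))) \<longlongrightarrow> partial_deriv k h x) (at t)"
    unfolding tendsto_iff dist_real_def
  proof (intro allI impI)
    fix e :: real assume "e > 0"
    then obtain \<delta> where \<delta>: "\<delta> > 0"
        "\<And>z. z \<in> coord_box n x \<delta> \<inter> W \<Longrightarrow> \<bar>partial_deriv k h z - partial_deriv k h x\<bar> < e"
      using cont[unfolded continuous_map_coord_box_iff[OF W]] x by blast
    from near[OF \<delta>(1)] near[OF \<epsilon>(1)]
    show "\<forall>\<^sub>F s in at t. \<bar>partial_deriv k h ((y s)(k := \<zeta> s)) - partial_deriv k h x\<bar> < e"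
    proof eventually_elim
      case (elim s)
      then show ?case
        using \<zeta>[OF elim(2)] \<epsilon>(2) by (intro \<delta>(2)) (auto intro: y_box)
    qed
  qed
  have "((\<lambda>s. (c s k - c t k) / (s - t)) \<longlongrightarrow> c') (at t)"
    using c' by (simp add: has_field_derivative_iff)
  from tendsto_mult[OF this lim]
  have "((\<lambda>s. (h ((y s)(k := c s k)) - h (y s) - 0) / (s - t)) \<longlongrightarrow> c' * partial_deriv k h x) (at t)"
  proof (rule Lim_transform_eventually)
    show "\<forall>\<^sub>F s in at t. (c s k - c t k) / (s - t) * partial_deriv k h ((y s)(k := \<zeta> s)) =
        (h ((y s)(k := c s k)) - h (y s) - 0) / (s - t)"
      using near[OF \<epsilon>(1)] by eventually_elim (simp add: \<zeta>)
  qed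
  moreover have "h ((y t)(k := c t k)) - h (y t) = 0"
    using y_k[of t] by simp
  ultimately have "((\<lambda>s. h ((y s)(k := c s k)) - h (y s)) has_field_derivative c' * partial_deriv k h x) (at t)"
    unfolding has_field_derivative_iff by simp
  then show ?thesis
    unfolding y_Suc by (simp add: x_def y_def[abs_def])
qed

lemma C_infinity_partial_deriv: "C_infinity n W h \<Longrightarrow> i < n \<Longrightarrow> C_infinity n W (partial_deriv i h)"
  unfolding C_infinity_def by (metis C_k.simps(2))

lemma C_infinity_continuous:
  "C_infinity n W h \<Longrightarrow> continuous_map (subtopology (Euclidean_space n) W) euclideanreal h"
  unfolding C_infinity_def by (metis C_k.simps(1))

lemma C_infinity_differentiable:
  assumes "C_infinity n W h" "i < n" "x \<in> W"
  shows "(\<lambda>t. h (x(i := t))) field_differentiable at (x i)"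
proof -
  have "C_k n (Suc 0) W h"
    using assms(1) by (simp only: C_infinity_def)
  then show ?thesis
    using assms(2,3) by simp
qed

text \<open>Moving the coordinates from \<open>c t\<close> to \<open>c s\<close> one after the other splits the increment of \<open>h\<close>
  into the terms of the preceding lemma.\<close>

lemma DERIV_C_infinity_along_curve:
  assumes W: "openin (Euclidean_space n) W" and h: "C_infinity n W h" and c: "smooth_curve W UNIV c"
  shows "((\<lambda>s. h (c s)) has_field_derivative
    (\<Sum>k<n. deriv (\<lambda>s. c s k) t * partial_deriv k h (c t))) (at t)"
proof -
  define y where "y k s = (\<lambda>j. if j < k then c s j else c t j)" for k s
  have cW: "c s \<in> W" for s
    using c by (auto simp: smooth_curve_def)
  have "c s j = 0" if "n \<le> j" for s j
    using cW[of s] openin_subset[OF W] that by (auto simp: topspace_Euclidean_space)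
  then have "y n s = c s" for s
    by (auto simp: y_def fun_eq_iff)
  moreover have "y 0 s = c t" for s
    by (simp add: y_def)
  ultimately have eq: "(\<lambda>s. h (c s)) = (\<lambda>s. h (c t) + (\<Sum>k<n. h (y (Suc k) s) - h (y k s)))"
    by (simp add: sum_lessThan_telescope[where f = "\<lambda>k. h (y k _)"])
  have "((\<lambda>s. h (y (Suc k) s) - h (y k s)) has_field_derivative
      deriv (\<lambda>s. c s k) t * partial_deriv k h (c t)) (at t)" if "k < n" for k
    unfolding y_def
  proof (rule DERIV_telescoping_term[OF W that])
    have "diff_times (Suc 0) UNIV (\<lambda>s. c s k)"
      using c unfolding smooth_curve_def by blast
    then show "((\<lambda>s. c s k) has_field_derivative deriv (\<lambda>s. c s k) t) (at t)"
      by (rule diff_times_has_deriv) simp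
  qed (use C_infinity_differentiable[OF h that] C_infinity_continuous[OF C_infinity_partial_deriv[OF h that]]
      smooth_curve_continuous[OF c] cW in auto)
  then have "((\<lambda>s. h (c t) + (\<Sum>k<n. h (y (Suc k) s) - h (y k s))) has_field_derivative
      0 + (\<Sum>k<n. deriv (\<lambda>s. c s k) t * partial_deriv k h (c t))) (at t)"
    by (intro DERIV_add DERIV_const DERIV_sum) auto
  then show ?thesis
    unfolding add_0 by (subst eq)
qed

lemma C_infinity_imp_curve_smooth:
  assumes W: "openin (Euclidean_space n) W" and h: "C_infinity n W h"
  shows "curve_smooth W h"
proof -
  have "diff_times k UNIV (\<lambda>t. h (c t))" if c: "smooth_curve W UNIV c" for c k
    using h
  proof (induction k arbitrary: h)
    case (Suc k)
    show ?case
    proof (rule diff_times_SucI[OF open_UNIV DERIV_C_infinity_along_curve[OF W Suc.prems c]])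
      have "diff_times (Suc k) UNIV (\<lambda>s. c s i)" for i
        using c unfolding smooth_curve_def by blast
      then have "diff_times k UNIV (\<lambda>t. deriv (\<lambda>s. c s i) t)" for i
        by (rule diff_times_deriv)
      then show "diff_times k UNIV (\<lambda>t. \<Sum>i<n. deriv (\<lambda>s. c s i) t * partial_deriv i h (c t))"
        using C_infinity_partial_deriv[OF Suc.prems]
        by (intro diff_times_sum diff_times_mult Suc.IH) auto
    qed
  qed simp
  then show ?thesis
    by (simp add: curve_smooth_def)
qed

section \<open>Smooth functions on manifolds and orbit spaces\<close>

lemma chart_inverse_continuous:
  assumes "chart n X U \<phi>"
  shows "continuous_map (subtopology (Euclidean_space n) (\<phi> ` U)) X (inv_into U \<phi>)"
proof -
  have U: "U \<subseteq> topspace X" "\<phi> ` U \<subseteq> topspace (Euclidean_space n)"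
    using assms unfolding chart_def by (auto dest!: openin_subset)
  obtain \<psi> where \<psi>: "homeomorphic_maps (subtopology X U) (subtopology (Euclidean_space n) (\<phi> ` U)) \<phi> \<psi>"
    using assms unfolding chart_def homeomorphic_map_maps by blast
  then have "inj_on \<phi> U"
    using U unfolding homeomorphic_maps_def by (auto intro!: inj_on_inverseI[of _ \<psi>])
  then have "\<psi> x = inv_into U \<phi> x" if "x \<in> \<phi> ` U" for x
    using that \<psi> U unfolding homeomorphic_maps_def by auto
  moreover have "continuous_map (subtopology (Euclidean_space n) (\<phi> ` U)) X \<psi>"
    using \<psi> unfolding homeomorphic_maps_def by (blast intro: continuous_map_into_fulltopology)
  ultimately show ?thesis
    by (elim continuous_map_eq) simp
qed

lemma smooth_functions_continuous:
  assumes X: "smooth_manifold n X B" and f: "f \<in> smooth_functions n B"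
  shows "continuous_map X euclideanreal f"
  unfolding continuous_map
proof (intro conjI allI impI)
  fix V :: "real set" assume V: "openin euclideanreal V"
  show "openin X {x \<in> topspace X. f x \<in> V}"
  proof (subst openin_subopen, intro ballI)
    fix x assume x: "x \<in> {x \<in> topspace X. f x \<in> V}"
    then obtain U \<phi> where U: "(U, \<phi>) \<in> B" "x \<in> U"
      using X unfolding smooth_manifold_def by blast
    have \<phi>: "chart n X U \<phi>" and "C_infinity n (\<phi> ` U) (\<lambda>x. f (inv_into U \<phi> x))"
      using X f U(1) unfolding smooth_manifold_def smooth_functions_def by auto
    then have "continuous_map (subtopology (Euclidean_space n) (\<phi> ` U)) euclideanreal (\<lambda>x. f (inv_into U \<phi> x))"
      by (intro C_infinity_continuous)
    moreover have "continuous_map (subtopology X U) (subtopology (Euclidean_space n) (\<phi> ` U)) \<phi>"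
      using \<phi> unfolding chart_def by (blast intro: homeomorphic_imp_continuous_map)
    ultimately have "continuous_map (subtopology X U) euclideanreal ((\<lambda>x. f (inv_into U \<phi> x)) \<circ> \<phi>)"
      by (rule continuous_map_compose[rotated])
    moreover have "topspace (subtopology X U) = U" "openin X U"
      using \<phi> unfolding chart_def by (auto dest: openin_subset)
    moreover have "inj_on \<phi> U"
      using \<phi> homeomorphic_imp_injective_map calculation(2) unfolding chart_def by metis
    ultimately have "continuous_map (subtopology X U) euclideanreal f"
      by (elim continuous_map_eq) auto
    then have "openin (subtopology X U) {x \<in> U. f x \<in> V}"
      using V \<open>topspace (subtopology X U) = U\<close> openin_continuous_map_preimage by fastforce
    then have "openin X {x \<in> U. f x \<in> V}"
      using \<open>openin X U\<close> by (simp add: openin_open_subtopology)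
    then show "\<exists>T. openin X T \<and> x \<in> T \<and> T \<subseteq> {x \<in> topspace X. f x \<in> V}"
      using x U(2) openin_subset[OF \<open>openin X U\<close>] by (intro exI[of _ "{x \<in> U. f x \<in> V}"]) auto
  qed
qed auto

lemma smooth_curve_continuous_map:
  assumes W: "W \<subseteq> topspace (Euclidean_space n)" and c: "smooth_curve W UNIV c"
  shows "continuous_map euclideanreal (subtopology (Euclidean_space n) W) c"
  using assms smooth_curve_continuous[OF c]
  unfolding continuous_map_in_subtopology Euclidean_space_def continuous_map_componentwise_UNIV
  by (auto simp: smooth_curve_def)

lemma orbit_translate:
  assumes "group_action G E \<Phi>" "g \<in> carrier G" "m \<in> E"
  shows "orbit G \<Phi> (\<Phi> g m) = orbit G \<Phi> m"
proof -
  interpret group_action G E \<Phi> by fact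
  have gm: "\<Phi> g m \<in> E"
    using element_image[OF assms(2,3)] by simp
  have 1: "\<Phi> g m \<in> orbit G \<Phi> m"
    using assms(2) by (auto simp: orbit_def)
  then have 2: "m \<in> orbit G \<Phi> (\<Phi> g m)"
    using orbit_sym[OF assms(3) gm] by blast
  have E: "z \<in> E" if "z \<in> orbit G \<Phi> y" "y \<in> E" for y z
    using that element_image by (auto simp: orbit_def)
  show ?thesis
    using 1 2 orbit_trans[OF assms(3) gm] orbit_trans[OF gm assms(3)] E gm assms(3) by blast
qed

lemma orbit_smooth_functions_subset_Phi0:
  assumes X: "smooth_manifold n X B"
  shows "orbit_smooth_functions G n X B \<Phi> \<subseteq>
    Phi0 (orbit_space G X \<Phi>) (Gamma0 (orbit_space G X \<Phi>) (orbit_smooth_functions G n X B \<Phi>))"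
proof
  fix f assume f: "f \<in> orbit_smooth_functions G n X B \<Phi>"
  then have "continuous_map X euclideanreal (f \<circ> orbit G \<Phi>)"
    by (intro smooth_functions_continuous[OF X])
      (simp add: orbit_smooth_functions_def invariant_smooth_functions_def)
  then have "continuous_map (orbit_space G X \<Phi>) euclideanreal f"
    by (rule continuous_compose_quotient_map[OF quotient_map_orbit])
  then show "f \<in> Phi0 (orbit_space G X \<Phi>) (Gamma0 (orbit_space G X \<Phi>) (orbit_smooth_functions G n X B \<Phi>))"
    using f by (simp add: Phi0_def Gamma0_def)
qed

text \<open>These curves are the only members of \<open>\<Gamma>\<^sub>0\<close> that the proof tests against: already they are
  numerous enough for Boman's theorem in each chart.\<close>

lemma projected_curve_in_Gamma0:
  assumes X: "smooth_manifold n X B" and U: "(U, \<phi>) \<in> B" and c: "smooth_curve (\<phi> ` U) UNIV c"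
  shows "(\<lambda>t. orbit G \<Phi> (inv_into U \<phi> (c t))) \<in>
    Gamma0 (orbit_space G X \<Phi>) (orbit_smooth_functions G n X B \<Phi>)"
proof -
  have \<phi>: "chart n X U \<phi>"
    using X U unfolding smooth_manifold_def by auto
  then have open_image: "openin (Euclidean_space n) (\<phi> ` U)"
    by (simp add: chart_def)
  have "continuous_map euclideanreal (orbit_space G X \<Phi>) (orbit G \<Phi> \<circ> (inv_into U \<phi> \<circ> c))"
    using smooth_curve_continuous_map[OF openin_subset[OF open_image] c] chart_inverse_continuous[OF \<phi>]
      quotient_imp_continuous_map[OF quotient_map_orbit]
    by (intro continuous_map_compose)
  moreover have "smooth_real (f \<circ> (\<lambda>t. orbit G \<Phi> (inv_into U \<phi> (c t))))"
    if "f \<in> orbit_smooth_functions G n X B \<Phi>" for f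
  proof -
    have "C_infinity n (\<phi> ` U) (\<lambda>x. (f \<circ> orbit G \<Phi>) (inv_into U \<phi> x))"
      using that U
      by (auto simp: orbit_smooth_functions_def invariant_smooth_functions_def smooth_functions_def)
    then have "curve_smooth (\<phi> ` U) (\<lambda>x. (f \<circ> orbit G \<Phi>) (inv_into U \<phi> x))"
      by (rule C_infinity_imp_curve_smooth[OF open_image])
    then show ?thesis
      using c by (simp add: curve_smooth_def smooth_real_iff o_def)
  qed
  ultimately show ?thesis
    by (simp add: Gamma0_def o_def)
qed

lemma Phi0_subset_orbit_smooth_functions:
  assumes X: "smooth_manifold n X B" and act: "group_action G (topspace X) \<Phi>"
  shows "Phi0 (orbit_space G X \<Phi>) (Gamma0 (orbit_space G X \<Phi>) (orbit_smooth_functions G n X B \<Phi>))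
    \<subseteq> orbit_smooth_functions G n X B \<Phi>"
proof
  fix f assume f: "f \<in> Phi0 (orbit_space G X \<Phi>) (Gamma0 (orbit_space G X \<Phi>) (orbit_smooth_functions G n X B \<Phi>))"
  have "C_infinity n (\<phi> ` U) (\<lambda>x. (f \<circ> orbit G \<Phi>) (inv_into U \<phi> x))" if U: "(U, \<phi>) \<in> B" for U \<phi>
  proof (rule curve_smooth_imp_C_infinity)
    have \<phi>: "chart n X U \<phi>"
      using X U unfolding smooth_manifold_def by auto
    then show "openin (Euclidean_space n) (\<phi> ` U)"
      by (simp add: chart_def)
    have "continuous_map X euclideanreal (f \<circ> orbit G \<Phi>)"
      using f quotient_imp_continuous_map[OF quotient_map_orbit]
      by (intro continuous_map_compose) (auto simp: Phi0_def)
    from continuous_map_compose[OF chart_inverse_continuous[OF \<phi>] this]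
    show "continuous_map (subtopology (Euclidean_space n) (\<phi> ` U)) euclideanreal
        (\<lambda>x. (f \<circ> orbit G \<Phi>) (inv_into U \<phi> x))"
      by (simp add: o_def)
    show "curve_smooth (\<phi> ` U) (\<lambda>x. (f \<circ> orbit G \<Phi>) (inv_into U \<phi> x))"
      unfolding curve_smooth_def
    proof (intro allI impI)
      fix c k assume "smooth_curve (\<phi> ` U) UNIV c"
      from projected_curve_in_Gamma0[OF X U this]
      have "smooth_real (f \<circ> (\<lambda>t. orbit G \<Phi> (inv_into U \<phi> (c t))))"
        using f unfolding Phi0_def by blast
      then show "diff_times k UNIV (\<lambda>t. (f \<circ> orbit G \<Phi>) (inv_into U \<phi> (c t)))"
        by (simp add: smooth_real_iff o_def)
    qed
  qed
  then have "f \<circ> orbit G \<Phi> \<in> smooth_functions n B"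
    by (auto simp: smooth_functions_def)
  then show "f \<in> orbit_smooth_functions G n X B \<Phi>"
    using orbit_translate[OF act]
    by (simp add: orbit_smooth_functions_def invariant_smooth_functions_def)
qed

theorem claim6p2p5:
  fixes d n :: nat
    and G :: "('g, 'r) monoid_scheme" and T :: "'g topology" and A :: "'g atlas"
    and X :: "'m topology" and B :: "'m atlas"
    and \<Phi> :: "'g \<Rightarrow> 'm \<Rightarrow> 'm"
  assumes "lie_group d T A G"
    and "smooth_manifold n X B"
    and "proper_lie_action d T A G n X B \<Phi>"
  shows "continuously_reflexive (orbit_space G X \<Phi>) (orbit_smooth_functions G n X B \<Phi>) \<and>
         orbit_smooth_functions G n X B \<Phi> =
           Phi0 (orbit_space G X \<Phi>)
             (Gamma0 (orbit_space G X \<Phi>) (orbit_smooth_functions G n X B \<Phi>))"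
proof -
  have "group_action G (topspace X) \<Phi>"
    using assms(3) by (simp add: proper_lie_action_def)
  from Phi0_subset_orbit_smooth_functions[OF assms(2) this]
    orbit_smooth_functions_subset_Phi0[OF assms(2), of G \<Phi>]
  show ?thesis
    by (simp add: continuously_reflexive_def subset_antisym)
qed

end
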